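(* Let $\mathcal{H}$ be a complex Hilbert space, let $N\geqslant 2$, and let $A_1,\ldots,A_N$ be bounded self-adjoint operators in $\mathcal{H}$ such that $A_iA_j$ is compact for all $i\neq j$. For $\varepsilon\geqslant 0$ let $$\mathcal{H}_\varepsilon=\bigcap_{i=1}^N E_{A_i}([-\varepsilon,\varepsilon])\mathcal{H}$$ (so that $\mathcal{H}_0=\bigcap_{i=1}^N \mathrm{Ker}(A_i)$). Then $\sum_{i=1}^N \mathrm{Ran}(A_i)$ is closed in $\mathcal{H}$ if and only if $\mathcal{H}_\varepsilon=\mathcal{H}_0$ for some $\varepsilon>0$.
   Context: For a bounded self-adjoint operator $B$ in $\mathcal{H}$, $E_B(\cdot)$ denotes its projection-valued spectral measure (on Borel subsets of $\mathbb{R}$). $\mathrm{Ran}$ and $\mathrm{Ker}$ denote range and kernel, and $\sum_{i=1}^N \mathrm{Ran}(A_i)=\{\sum_{i=1}^N A_ix_i \mid x_i\in\mathcal{H}\}$ is the algebraic sum of the ranges. *)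

theory Defs
  imports "HOL-Analysis.Analysis"
begin

text \<open>
  The real vector space structure, norm and topology of a complex inner product space are those of
  the library class \<^class>\<open>real_normed_vector\<close>; the axioms tie them to the complex scalar
  multiplication and to the inner product, which is linear in its first argument.
\<close>

class complex_inner = real_normed_vector +
  fixes scaleC :: "complex \<Rightarrow> 'a \<Rightarrow> 'a"  (infixr \<open>*\<^sub>C\<close> 75)
    and cinner :: "'a \<Rightarrow> 'a \<Rightarrow> complex"
  assumes scaleC_add_right: "c *\<^sub>C (x + y) = c *\<^sub>C x + c *\<^sub>C y"
    and scaleC_add_left: "(c + d) *\<^sub>C x = c *\<^sub>C x + d *\<^sub>C x"
    and scaleC_scaleC: "c *\<^sub>C d *\<^sub>C x = (c * d) *\<^sub>C x"
    and scaleC_of_real: "complex_of_real r *\<^sub>C x = scaleR r x"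
    and cinner_commute: "cinner x y = cnj (cinner y x)"
    and cinner_add_left: "cinner (x + y) z = cinner x z + cinner y z"
    and cinner_scaleC_left: "cinner (c *\<^sub>C x) y = c * cinner x y"
    and norm_eq_sqrt_cinner: "norm x = sqrt (Re (cinner x x))"
    and cinner_ge_zero: "0 \<le> Re (cinner x x)"

class complex_hilbert = complex_inner + complete_space

definition bounded_clinear :: "('a::complex_inner \<Rightarrow> 'a) \<Rightarrow> bool" where
  "bounded_clinear T \<longleftrightarrow> bounded_linear T \<and> (\<forall>c x. T (c *\<^sub>C x) = c *\<^sub>C T x)"

definition bounded_selfadjoint :: "('a::complex_inner \<Rightarrow> 'a) \<Rightarrow> bool" where
  "bounded_selfadjoint T \<longleftrightarrow>
     bounded_clinear T \<and> (\<forall>x y. cinner (T x) y = cinner x (T y))"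

definition compact_operator :: "('a::complex_inner \<Rightarrow> 'a) \<Rightarrow> bool" where
  "compact_operator T \<longleftrightarrow>
     bounded_clinear T \<and> (\<forall>S. bounded S \<longrightarrow> compact (closure (T ` S)))"

definition orthogonal_projection :: "('a::complex_inner \<Rightarrow> 'a) \<Rightarrow> bool" where
  "orthogonal_projection P \<longleftrightarrow> bounded_selfadjoint P \<and> P \<circ> P = P"

text \<open>
  A projection-valued measure on the Borel sets of the real line; countable additivity is with
  respect to the strong operator topology.
\<close>

definition projection_valued_measure :: "(real set \<Rightarrow> 'a::complex_inner \<Rightarrow> 'a) \<Rightarrow> bool" where
  "projection_valued_measure E \<longleftrightarrow>
     (\<forall>S \<in> sets borel. orthogonal_projection (E S)) \<and>
     E {} = (\<lambda>x. 0) \<and> E UNIV = id \<and>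
     (\<forall>F :: nat \<Rightarrow> real set. range F \<subseteq> sets borel \<longrightarrow> disjoint_family F \<longrightarrow>
        (\<forall>x. (\<lambda>n. E (F n) x) sums E (\<Union>n. F n) x))"

definition scalar_measure ::
    "(real set \<Rightarrow> 'a::complex_inner \<Rightarrow> 'a) \<Rightarrow> 'a \<Rightarrow> real measure" where
  "scalar_measure E x = measure_of UNIV (sets borel) (\<lambda>S. ennreal (Re (cinner (E S x) x)))"

text \<open>
  The identity $B = \int \lambda \, dE(\lambda)$ is read weakly,
  $\langle Bx, x\rangle = \int \lambda \, d\langle E(\lambda)x, x\rangle$ for all $x$. A spectral
  measure of a bounded operator is supported in a bounded interval, so these integrals exist.
\<close>

definition is_spectral_measure ::
    "('a::complex_inner \<Rightarrow> 'a) \<Rightarrow> (real set \<Rightarrow> 'a \<Rightarrow> 'a) \<Rightarrow> bool" where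
  "is_spectral_measure B E \<longleftrightarrow>
     projection_valued_measure E \<and>
     (\<exists>r. E {-r..r} = id) \<and>
     (\<forall>x. cinner (B x) x = complex_of_real (\<integral>t. t \<partial>scalar_measure E x))"

text \<open>
  By the spectral theorem, a bounded self-adjoint operator on a complex Hilbert space has a spectral
  measure, and its values on Borel sets are unique; the choice affects only its values on
  non-Borel sets, which are irrelevant.
\<close>

definition spectral_measure ::
    "('a::complex_hilbert \<Rightarrow> 'a) \<Rightarrow> real set \<Rightarrow> 'a \<Rightarrow> 'a" where
  "spectral_measure B = (SOME E. is_spectral_measure B E)"

definition joint_spectral_subspace ::
    "nat \<Rightarrow> (nat \<Rightarrow> 'a::complex_hilbert \<Rightarrow> 'a) \<Rightarrow> real \<Rightarrow> 'a set" where
  "joint_spectral_subspace N A \<epsilon> = (\<Inter>i\<in>{1..N}. range (spectral_measure (A i) {-\<epsilon>..\<epsilon>}))"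

end

theory Submission
  imports Defs
begin

text \<open>
  Let \<open>Q i\<close> be the spectral projection of \<open>A i\<close> off \<open>[-\<epsilon>, \<epsilon>]\<close>. Since \<open>A i\<close> is invertible on the range
  of \<open>Q i\<close>, the products \<open>Q i \<circ> Q j\<close> are compact for \<open>i \<noteq> j\<close>, so the Gram operator of the ranges of the
  \<open>Q i\<close> is a compact perturbation of the identity and their sum is closed. Its orthogonal complement is
  \<open>H\<^sub>\<epsilon>\<close>, while that of the sum of the ranges of the \<open>A i\<close> is \<open>H\<^sub>0\<close>; if the two agree, the two sums
  coincide. Conversely, if \<open>H\<^sub>\<epsilon> \<noteq> H\<^sub>0\<close> for all \<open>\<epsilon>\<close>, there are \<open>z n\<close> orthogonal to \<open>H\<^sub>0\<close> with
  norms tending to infinity and \<open>norm (A i (z n)) \<le> 1\<close>; when the sum of the ranges is closed they are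
  weakly bounded, against the uniform boundedness principle.

  The spectral theorem is obtained from the operator \<open>sqrt (T\<^sup>2)\<close>, a norm convergent binomial series:
  with \<open>T = B - l\<close>, the projection onto the kernel of \<open>T + sqrt (T\<^sup>2)\<close> is the value at \<open>l\<close> of the resolution
  of the identity of \<open>B\<close>.
\<close>

section \<open>The real inner product and orthogonal projections\<close>

text \<open>Since \<open>spectral_measure\<close> is a choice, there are two separate tasks: to
  construct some \<open>E\<close> satisfying \<open>is_spectral_measure\<close>, and to derive the
  facts about spectral subspaces from that predicate for an arbitrary such \<open>E\<close>. The
  predicate only gives the diagonal values of the form of \<open>B\<close>. These are additive over
  a Borel set and its complement, which forces the off-diagonal term to vanish; so \<open>E\<close>
  commutes with \<open>B\<close>, and the norm bounds follow. The binomial series serves for the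
  square root because its coefficients remain absolutely summable on the circle of convergence,
  which covers operators \<open>T\<close> with 0 in the spectrum. In the closedness argument the
  ranges of the \<open>Q i\<close> may intersect, so the Gram operator may have a kernel and
  decompositions are not unique. Decompositions of nearly minimal size take the place of its
  inverse. Throughout, the real part of the inner product is used, so that real analysis applies
  directly; complex linearity of the operators restores the complex statements.\<close>

definition rinner :: "'a::complex_inner \<Rightarrow> 'a \<Rightarrow> real" where
  "rinner x y = Re (cinner x y)"

lemma rinner_commute: "rinner x y = rinner y x"
  unfolding rinner_def by (metis cinner_commute complex_cnj(1) cnj.simps(1))

lemma rinner_self: "rinner x x = (norm x)\<^sup>2"
  unfolding rinner_def by (simp add: norm_eq_sqrt_cinner cinner_ge_zero)

lemma rinner_add_left: "rinner (x + y) z = rinner x z + rinner y z"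
  by (simp add: rinner_def cinner_add_left)

lemma rinner_scaleR_left: "rinner (r *\<^sub>R x) y = r * rinner x y"
  by (simp add: rinner_def cinner_scaleC_left flip: scaleC_of_real)

lemma rinner_add_right: "rinner z (x + y) = rinner z x + rinner z y"
  by (metis rinner_add_left rinner_commute)

lemma rinner_scaleR_right: "rinner x (r *\<^sub>R y) = r * rinner x y"
  by (metis rinner_scaleR_left rinner_commute)

lemma norm_add_sq: "(norm (x + y))\<^sup>2 = (norm x)\<^sup>2 + 2 * rinner x y + (norm y)\<^sup>2"
  for x y :: "'a::complex_inner"
  by (simp add: rinner_add_left rinner_add_right rinner_commute[of y x] flip: rinner_self)

lemma rinner_le_norm: "\<bar>rinner x y\<bar> \<le> norm x * norm y"
proof (cases "y = 0")
  case True
  then show ?thesis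
    using rinner_scaleR_right[of x 0 0] by simp
next
  case False
  \<comment> \<open>This real \<open>t\<close> minimizes
    \<open>norm (x + t *\<^sub>R y)\<close>.\<close>
  define t where "t = - (rinner x y / (norm y)\<^sup>2)"
  have "0 \<le> (norm (x + t *\<^sub>R y))\<^sup>2"
    by simp
  also have "\<dots> = (norm x)\<^sup>2 + 2 * t * rinner x y + t\<^sup>2 * (norm y)\<^sup>2"
    by (simp add: norm_add_sq rinner_scaleR_right power_mult_distrib)
  also have "\<dots> = (norm x)\<^sup>2 - (rinner x y)\<^sup>2 / (norm y)\<^sup>2"
    using False by (simp add: t_def field_simps power2_eq_square)
  finally have "(rinner x y)\<^sup>2 \<le> (norm x * norm y)\<^sup>2"
    using False by (simp add: field_simps power_mult_distrib)
  then show ?thesis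
    by (simp add: abs_le_square_iff[symmetric])
qed

interpretation rinner: bounded_bilinear rinner
proof
  show "\<exists>K. \<forall>a b. norm (rinner a b) \<le> norm a * norm b * K"
    by (rule exI[of _ 1]) (simp add: rinner_le_norm)
qed (simp_all add: rinner_add_left rinner_add_right rinner_scaleR_left rinner_scaleR_right)

lemmas rinner_simps = rinner_add_left rinner_add_right rinner.diff_left rinner.diff_right
  rinner_scaleR_left rinner_scaleR_right

lemma norm_diff_sq: "(norm (x - y))\<^sup>2 = (norm x)\<^sup>2 - 2 * rinner x y + (norm y)\<^sup>2"
  for x y :: "'a::complex_inner"
  by (simp add: rinner_simps rinner_commute[of y x] flip: rinner_self)

lemma scaleC_diff_right: "c *\<^sub>C (x - y) = c *\<^sub>C x - c *\<^sub>C y"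
  using scaleC_add_right[of c "x - y" y] by (simp add: algebra_simps)

lemma scaleC_zero_right: "c *\<^sub>C 0 = 0"
  using scaleC_diff_right[of c 0 0] by simp

lemma scaleC_scaleR: "c *\<^sub>C (r *\<^sub>R x) = r *\<^sub>R (c *\<^sub>C x)"
  by (simp add: scaleC_scaleC mult.commute flip: scaleC_of_real)

lemma scaleC_sum_right: "c *\<^sub>C (\<Sum>i\<in>I. f i) = (\<Sum>i\<in>I. c *\<^sub>C f i)"
  by (induction I rule: infinite_finite_induct) (simp_all add: scaleC_zero_right scaleC_add_right)

lemma cinner_scaleC_right: "cinner x (c *\<^sub>C y) = cnj c * cinner x y"
  by (metis cinner_commute cinner_scaleC_left complex_cnj_cnj complex_cnj_mult)

lemma rinner_scaleC_left: "rinner (c *\<^sub>C x) y = rinner x (cnj c *\<^sub>C y)"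
  by (simp add: rinner_def cinner_scaleC_left cinner_scaleC_right)

text \<open>Conjugate linearity in the second argument turns the imaginary part into the real part
  at \<open>\<i> *\<^sub>C y\<close>. Identities for \<open>rinner\<close> between complex linear
  maps therefore lift to \<open>cinner\<close>.\<close>

lemma cinner_eq_rinner: "cinner x y = Complex (rinner x y) (rinner x (\<i> *\<^sub>C y))"
  by (simp add: rinner_def cinner_scaleC_right complex_eq_iff)

lemma norm_scaleC: "norm (c *\<^sub>C x) = cmod c * norm x"
proof -
  have "(norm (c *\<^sub>C x))\<^sup>2 = rinner x ((cnj c * c) *\<^sub>C x)"
    by (simp add: rinner_scaleC_left scaleC_scaleC flip: rinner_self)
  also have "cnj c * c = complex_of_real ((cmod c)\<^sup>2)"
    by (metis complex_norm_square mult.commute of_real_power)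
  also have "rinner x (complex_of_real ((cmod c)\<^sup>2) *\<^sub>C x) = (cmod c * norm x)\<^sup>2"
    by (simp only: scaleC_of_real) (simp add: rinner_scaleR_right rinner_self power_mult_distrib)
  finally show ?thesis
    by (simp add: power2_eq_iff_nonneg)
qed

lemma bounded_linear_scaleC: "bounded_linear (\<lambda>x. c *\<^sub>C x)"
  by (rule bounded_linear_intro[where K = "cmod c"])
    (simp_all add: scaleC_add_right scaleC_scaleR norm_scaleC mult.commute)

definition csubspace :: "'a::complex_inner set \<Rightarrow> bool" where
  "csubspace M \<longleftrightarrow> 0 \<in> M \<and> (\<forall>x\<in>M. \<forall>y\<in>M. x + y \<in> M) \<and> (\<forall>c. \<forall>x\<in>M. c *\<^sub>C x \<in> M)"

lemma csubspace_scaleR: "csubspace M \<Longrightarrow> x \<in> M \<Longrightarrow> r *\<^sub>R x \<in> M"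
  unfolding csubspace_def by (metis scaleC_of_real)

lemma csubspace_add: "csubspace M \<Longrightarrow> x \<in> M \<Longrightarrow> y \<in> M \<Longrightarrow> x + y \<in> M"
  by (simp add: csubspace_def)

lemma csubspace_INT: "(\<And>i. i \<in> I \<Longrightarrow> csubspace (M i)) \<Longrightarrow> csubspace (\<Inter>i\<in>I. M i)"
  by (simp add: csubspace_def)

lemma csubspace_diff: "csubspace M \<Longrightarrow> x \<in> M \<Longrightarrow> y \<in> M \<Longrightarrow> x - y \<in> M"
  using csubspace_scaleR[of M y "-1"] csubspace_add[of M x "-y"] by simp

lemma bounded_selfadjointD:
  assumes "bounded_selfadjoint T"
  shows "bounded_linear T" and "T (c *\<^sub>C x) = c *\<^sub>C T x" and "rinner (T x) y = rinner x (T y)"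
  using assms by (auto simp: bounded_selfadjoint_def bounded_clinear_def rinner_def)

lemma bounded_selfadjointI:
  assumes "bounded_linear T" and C: "\<And>c x. T (c *\<^sub>C x) = c *\<^sub>C T x"
    and R: "\<And>x y. rinner (T x) y = rinner x (T y)"
  shows "bounded_selfadjoint T"
  using assms unfolding bounded_selfadjoint_def bounded_clinear_def
  by (simp add: cinner_eq_rinner flip: C)

lemma orthogonal_projectionD:
  assumes "orthogonal_projection P"
  shows "bounded_selfadjoint P" and "P (P x) = P x"
  using assms unfolding orthogonal_projection_def by (simp, metis comp_apply)

lemma range_projection:
  assumes "orthogonal_projection P"
  shows "x \<in> range P \<longleftrightarrow> P x = x"
  using orthogonal_projectionD(2)[OF assms] by (auto intro: range_eqI[OF sym])

lemma rinner_projection: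
  assumes "orthogonal_projection P"
  shows "rinner (P x) x = (norm (P x))\<^sup>2"
  using bounded_selfadjointD(3)[OF orthogonal_projectionD(1)[OF assms], of "P x" x]
  by (simp add: orthogonal_projectionD(2)[OF assms] rinner_self)

lemma orthogonal_projection_compl:
  assumes "orthogonal_projection P"
  shows "orthogonal_projection (\<lambda>x. x - P x)"
proof -
  note P = bounded_selfadjointD[OF orthogonal_projectionD(1)[OF assms]]
  interpret bounded_linear P by (rule P)
  have "bounded_selfadjoint (\<lambda>x. x - P x)"
    by (intro bounded_selfadjointI bounded_linear_sub bounded_linear_ident P(1))
      (simp_all add: P scaleC_diff_right rinner_simps)
  then show ?thesis
    by (auto simp: orthogonal_projection_def diff orthogonal_projectionD(2)[OF assms])
qed

lemma norm_projection_pythagoras: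
  assumes "orthogonal_projection P"
  shows "(norm x)\<^sup>2 = (norm (P x))\<^sup>2 + (norm (x - P x))\<^sup>2"
  using rinner_projection[OF assms, of x] by (simp add: norm_diff_sq rinner_commute)

lemma norm_projection_le:
  assumes "orthogonal_projection P"
  shows "norm (P x) \<le> norm x"
proof -
  have "(norm (P x))\<^sup>2 \<le> (norm x)\<^sup>2"
    using norm_projection_pythagoras[OF assms, of x] by simp
  then show ?thesis
    by (rule power2_le_imp_le) simp
qed

lemma closed_range_projection:
  assumes "orthogonal_projection P"
  shows "closed (range P)"
proof -
  have "bounded_linear P"
    using assms bounded_selfadjointD(1) orthogonal_projectionD(1) by blast
  then have "closed {x. P x = x}"
    by (intro closed_Collect_eq continuous_intros linear_continuous_on)
  also have "{x. P x = x} = range P"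
    using range_projection[OF assms] by blast
  finally show ?thesis .
qed

lemma csubspace_range_projection:
  assumes "orthogonal_projection P"
  shows "csubspace (range P)"
proof -
  note P = bounded_selfadjointD[OF orthogonal_projectionD(1)[OF assms]]
  interpret bounded_linear P by (rule P)
  show ?thesis
    by (auto simp: csubspace_def range_projection[OF assms] zero add P orthogonal_projectionD(2)[OF assms])
qed

section \<open>The projection theorem\<close>

lemma nearest_point_exists:
  fixes M :: "'a::complex_hilbert set"
  assumes "closed M" "csubspace M"
  obtains y where "y \<in> M" and "\<And>z. z \<in> M \<Longrightarrow> norm (x - y) \<le> norm (x - z)"
proof -
  define D where "D = (\<lambda>y. (norm (x - y))\<^sup>2) ` M"
  define d where "d = Inf D"
  have "D \<noteq> {}" "bdd_below D"
    using \<open>csubspace M\<close> by (auto simp: D_def csubspace_def intro!: bdd_belowI[of _ 0])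
  then have lower: "d \<le> (norm (x - y))\<^sup>2" if "y \<in> M" for y
    unfolding d_def D_def using that by (intro cInf_lower) (auto simp: D_def)
  have "\<exists>y\<in>M. (norm (x - y))\<^sup>2 < d + 1 / Suc n" for n
    using \<open>D \<noteq> {}\<close> \<open>bdd_below D\<close> cInf_less_iff[of D "d + 1 / Suc n"] by (auto simp: d_def D_def)
  then obtain s where s: "\<And>n. s n \<in> M" "\<And>n. (norm (x - s n))\<^sup>2 < d + 1 / Suc n"
    by metis
  \<comment> \<open>Parallelogram law for \<open>x - s m\<close> and \<open>x - s n\<close>: the
    midpoint of \<open>s m\<close> and \<open>s n\<close> lies in \<open>M\<close>, so its squared
    distance from \<open>x\<close> is at least \<open>d\<close>, while the two given ones exceed
    \<open>d\<close> by less than \<open>1 / Suc m\<close> and \<open>1 / Suc n\<close>.\<close>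
  have para: "(norm (s m - s n))\<^sup>2 \<le> 2 / Suc m + 2 / Suc n" for m n
  proof -
    let ?u = "x - s m" and ?v = "x - s n"
    have "(norm (s m - s n))\<^sup>2 = (norm (?v - ?u))\<^sup>2"
      by simp
    also have "\<dots> = 2 * (norm ?u)\<^sup>2 + 2 * (norm ?v)\<^sup>2 - (norm (?u + ?v))\<^sup>2"
      unfolding norm_diff_sq[of ?v ?u] norm_add_sq[of ?u ?v] rinner_commute[of ?u ?v] by linarith
    also have "?u + ?v = 2 *\<^sub>R (x - (1/2) *\<^sub>R (s m + s n))"
      by (simp add: scaleR_diff_right scaleR_2)
    also have "(norm \<dots>)\<^sup>2 = 4 * (norm (x - (1/2) *\<^sub>R (s m + s n)))\<^sup>2"
      by (simp add: power_mult_distrib)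
    finally show ?thesis
      using lower[OF csubspace_scaleR[OF \<open>csubspace M\<close> csubspace_add[OF \<open>csubspace M\<close> s(1)[of m] s(1)[of n]], of "1/2"]]
        s(2)[of m] s(2)[of n] by linarith
  qed
  have "Cauchy s"
  proof (rule metric_CauchyI)
    fix e :: real assume "e > 0"
    obtain k where "4 / e\<^sup>2 < real k"
      using reals_Archimedean2 by blast
    then have k: "4 / Suc k < e\<^sup>2"
      using \<open>e > 0\<close> by (simp add: field_simps) (smt (verit) zero_less_power)
    have "dist (s m) (s n) < e" if "m \<ge> k" "n \<ge> k" for m n
    proof -
      have "2 / real (Suc m) \<le> 2 / Suc k" "2 / real (Suc n) \<le> 2 / Suc k"
        using that by (auto intro!: divide_left_mono)
      then have "(norm (s m - s n))\<^sup>2 < e\<^sup>2"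
        using para[of m n] k by linarith
      then show ?thesis
        using \<open>e > 0\<close> by (simp add: dist_norm power2_less_imp_less)
    qed
    then show "\<exists>k. \<forall>m\<ge>k. \<forall>n\<ge>k. dist (s m) (s n) < e"
      by blast
  qed
  then obtain y where y: "s \<longlonglongrightarrow> y"
    using Cauchy_convergent convergent_def by blast
  have "y \<in> M"
    using closed_sequentially[OF \<open>closed M\<close> _ y] s(1) by blast
  have "(\<lambda>n. (norm (x - s n))\<^sup>2) \<longlonglongrightarrow> (norm (x - y))\<^sup>2"
    by (intro tendsto_intros y)
  moreover have "(\<lambda>n. d + 1 / real (Suc n)) \<longlonglongrightarrow> d"
    using tendsto_add[OF tendsto_const LIMSEQ_inverse_real_of_nat, of d] by (simp add: inverse_eq_divide)
  ultimately have "(norm (x - y))\<^sup>2 \<le> d"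
    by (rule LIMSEQ_le) (use s(2) in \<open>auto intro!: less_imp_le\<close>)
  then have "norm (x - y) \<le> norm (x - z)" if "z \<in> M" for z
    by (meson lower[OF that] norm_ge_zero order_trans power2_le_imp_le)
  with \<open>y \<in> M\<close> that show ?thesis
    by blast
qed

lemma orthogonal_decomposition:
  fixes M :: "'a::complex_hilbert set"
  assumes "closed M" "csubspace M"
  obtains y where "y \<in> M" and "\<And>z. z \<in> M \<Longrightarrow> rinner (x - y) z = 0"
proof -
  obtain y where y: "y \<in> M" and min: "\<And>z. z \<in> M \<Longrightarrow> norm (x - y) \<le> norm (x - z)"
    using nearest_point_exists[OF assms] by blast
  have "rinner (x - y) z = 0" if "z \<in> M" for z
  proof (cases "z = 0")
    case True
    then show ?thesis by (simp add: rinner.zero_right)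
  next
    case False
    \<comment> \<open>The best multiple of \<open>z\<close> to add to \<open>y\<close>: it would
      bring the point strictly closer to \<open>x\<close> unless the inner product vanishes.\<close>
    define t where "t = rinner (x - y) z / (norm z)\<^sup>2"
    have "norm (x - y) \<le> norm (x - (y + t *\<^sub>R z))"
      using assms that y by (intro min csubspace_add csubspace_scaleR)
    then have "(norm (x - y))\<^sup>2 \<le> (norm ((x - y) - t *\<^sub>R z))\<^sup>2"
      by (simp add: diff_diff_eq power_mono)
    also have "\<dots> = (norm (x - y))\<^sup>2 - 2 * t * rinner (x - y) z + t\<^sup>2 * (norm z)\<^sup>2"
      by (simp only: norm_diff_sq) (simp add: rinner_scaleR_right power_mult_distrib)
    also have "\<dots> = (norm (x - y))\<^sup>2 - (rinner (x - y) z)\<^sup>2 / (norm z)\<^sup>2"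
      using False by (simp add: t_def field_simps power2_eq_square)
    finally show ?thesis
      using False by (simp add: divide_le_0_iff)
  qed
  with y that show ?thesis
    by blast
qed

lemma projection_exists:
  fixes M :: "'a::complex_hilbert set"
  assumes "closed M" "csubspace M"
  obtains P where "orthogonal_projection P" and "range P = M"
    and "\<And>x z. z \<in> M \<Longrightarrow> rinner (x - P x) z = 0"
proof -
  have "\<exists>P. \<forall>x. P x \<in> M \<and> (\<forall>z\<in>M. rinner (x - P x) z = 0)"
    by (rule choice) (metis orthogonal_decomposition[OF assms])
  then obtain P where mem: "\<And>x. P x \<in> M" and orth: "\<And>x z. z \<in> M \<Longrightarrow> rinner (x - P x) z = 0"
    by metis
  have orth': "rinner (P x) z = rinner x z" if "z \<in> M" for x z
    using orth[OF that, of x] by (simp add: rinner.diff_left)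
  have scaleC_mem: "c *\<^sub>C x \<in> M" if "x \<in> M" for c x
    using that assms(2) by (simp add: csubspace_def)
  \<comment> \<open>Orthogonality of the remainder determines \<open>P x\<close>. Additivity,
    complex homogeneity and idempotence then each amount to checking that the expected value
    satisfies this characterization.\<close>
  have unique: "P x = y" if "y \<in> M" "\<And>z. z \<in> M \<Longrightarrow> rinner (x - y) z = 0" for x y
  proof -
    have "P x - y \<in> M"
      using that mem assms csubspace_diff by blast
    then have "rinner (P x - y) (P x - y) = 0"
      using that(2)[of "P x - y"] orth[of "P x - y" x] by (simp add: rinner.diff_left)
    then show ?thesis
      by (simp add: rinner_self)
  qed
  have "P (x + y) = P x + P y" for x y
    by (rule unique) (simp_all add: rinner_simps mem orth' csubspace_add[OF assms(2)])
  moreover have C: "P (c *\<^sub>C x) = c *\<^sub>C P x" for c x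
    by (rule unique) (simp_all add: rinner.diff_left rinner_scaleC_left mem orth' scaleC_mem)
  moreover have sa: "rinner (P x) y = rinner x (P y)" for x y
    by (metis mem orth' rinner_commute)
  moreover have idem: "P (P x) = P x" for x
    by (rule unique[OF mem]) (simp add: rinner.zero_left)
  moreover have "norm (P x) \<le> norm x" for x
  proof -
    have "(norm (P x))\<^sup>2 = rinner (P x) x"
      using sa[of "P x" x] by (simp add: idem rinner_self)
    also have "\<dots> \<le> norm (P x) * norm x"
      using rinner_le_norm[of "P x" x] by simp
    finally show ?thesis
      by (cases "P x = 0") (auto simp: power2_eq_square)
  qed
  moreover have "P (r *\<^sub>R x) = r *\<^sub>R P x" for r x
    using C[of "complex_of_real r" x] by (simp add: scaleC_of_real)
  ultimately have "bounded_linear P"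
    by (intro bounded_linear_intro[of _ 1]) auto
  then have "orthogonal_projection P"
    unfolding orthogonal_projection_def
    by (intro conjI bounded_selfadjointI C sa) (auto simp: idem)
  moreover have "range P = M"
  proof -
    have "P x = x" if "x \<in> M" for x
      by (rule unique[OF that]) (simp add: rinner.zero_left)
    then show ?thesis
      using mem by (metis image_subset_iff subsetI subset_antisym rangeI)
  qed
  ultimately show thesis
    using that orth by blast
qed

text \<open>Polarization: expanding the form at \<open>x + y\<close> and using symmetry recovers
  \<open>rinner (S x) y\<close> from diagonal values.\<close>

lemma selfadjoint_eqI:
  assumes S: "bounded_selfadjoint S" and T: "bounded_selfadjoint T"
    and eq: "\<And>x. rinner (S x) x = rinner (T x) x"
  shows "S = T"
proof
  fix x
  note S = bounded_selfadjointD[OF S] and T = bounded_selfadjointD[OF T]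
  interpret S: bounded_linear S by (rule S)
  interpret T: bounded_linear T by (rule T)
  have "rinner (S x) y = rinner (T x) y" for y
    using eq[of "x + y"] eq[of x] eq[of y] S(3)[of y x] T(3)[of y x]
    by (simp add: S.add T.add rinner_simps rinner_commute)
  then have "rinner (S x - T x) (S x - T x) = 0"
    by (simp add: rinner.diff_left)
  then show "S x = T x"
    by (simp add: rinner_self)
qed

text \<open>At the vector \<open>Q x\<close> the inequality reads \<open>(norm (P (Q x)))\<^sup>2 +
  (norm (Q x))\<^sup>2 \<le> (norm (Q x))\<^sup>2\<close>. This is how additivity of measures
  becomes orthogonality of spectral projections.\<close>

lemma projections_orthogonal:
  assumes P: "orthogonal_projection P" and Q: "orthogonal_projection Q"
    and le: "\<And>x. rinner (P x) x + rinner (Q x) x \<le> (norm x)\<^sup>2"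
  shows "P (Q x) = 0"
  using le[of "Q x"] orthogonal_projectionD(2)[OF Q, of x]
  by (simp add: rinner_projection[OF P] rinner_self)

section \<open>The absolute value of a self-adjoint operator\<close>

instance complex_hilbert \<subseteq> banach ..

text \<open>The Taylor coefficients of \<open>\<lambda>z. sqrt (1 - z)\<close> at 0.\<close>

definition sqrt_coeff :: "nat \<Rightarrow> real" where
  "sqrt_coeff k = (-1) ^ k * (1/2 gchoose k)"

lemma sqrt_coeff_0 [simp]: "sqrt_coeff 0 = 1"
  by (simp add: sqrt_coeff_def)

text \<open>The coefficient is a rising factorial starting at \<open>-1/2\<close>, divided by a
  factorial; only the first factor is negative.\<close>

lemma sqrt_coeff_nonpos: "k > 0 \<Longrightarrow> sqrt_coeff k \<le> 0"
proof -
  assume "k > 0"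
  then obtain j where j: "k = Suc j"
    using gr0_implies_Suc by blast
  have "sqrt_coeff k = pochhammer (-1/2) k / fact k"
    by (simp add: sqrt_coeff_def gbinomial_pochhammer flip: power_mult_distrib mult.assoc)
  also have "\<dots> = - (pochhammer (1/2) j / (2 * fact k))"
    by (simp add: j pochhammer_rec)
  also have "\<dots> \<le> 0"
    using pochhammer_pos[of "1/2::real" j] by simp
  finally show ?thesis .
qed

text \<open>The partial sums have a closed form, up to sign the binomial coefficients of
  \<open>-1/2\<close>, and the sign makes them positive. Both the absolute summability and the
  positivity of the square root rest on this.\<close>

lemma sum_sqrt_coeff_nonneg: "0 \<le> (\<Sum>k\<le>m. sqrt_coeff k)"
proof -
  have "(\<Sum>k\<le>m. sqrt_coeff k) = (-1) ^ m * (1/2 - 1 gchoose m)"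
    using gbinomial_sum_lower_neg[of "1/2::real" m] by (simp add: sqrt_coeff_def mult.commute)
  also have "\<dots> = pochhammer (1/2) m / fact m"
    by (simp add: gbinomial_pochhammer flip: power_mult_distrib mult.assoc)
  also have "\<dots> \<ge> 0"
    using pochhammer_pos[of "1/2::real" m] by simp
  finally show ?thesis .
qed

text \<open>Only the coefficient at 0 is positive, and it equals 1, so the absolute sum is 2 minus a
  nonnegative partial sum.\<close>

lemma sum_abs_sqrt_coeff_le: "(\<Sum>k<m. \<bar>sqrt_coeff k\<bar>) \<le> 2"
proof (cases m)
  case (Suc n)
  have "(\<Sum>k\<le>n. \<bar>sqrt_coeff k\<bar>) = (\<Sum>k\<le>n. 2 * of_bool (k = 0) - sqrt_coeff k)"
  proof (rule sum.cong[OF refl])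
    show "\<bar>sqrt_coeff k\<bar> = 2 * of_bool (k = 0) - sqrt_coeff k" for k
      using sqrt_coeff_nonpos[of k] by (cases "k = 0") auto
  qed
  also have "\<dots> = 2 - (\<Sum>k\<le>n. sqrt_coeff k)"
    by (simp add: sum_subtractf flip: sum_distrib_left)
  finally show ?thesis
    using sum_sqrt_coeff_nonneg[of n] by (simp add: Suc lessThan_Suc_atMost)
qed simp

lemma summable_abs_sqrt_coeff: "summable (\<lambda>k. \<bar>sqrt_coeff k\<bar>)"
  by (rule summableI_nonneg_bounded[of _ 2]) (simp_all add: sum_abs_sqrt_coeff_le)

text \<open>The coefficients of the square of \<open>sqrt (1 - z)\<close>, read off from the formal
  power series identity for the exponents \<open>1/2 + 1/2 = 1\<close> after restoring the
  alternating signs.\<close>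

lemma sqrt_coeff_convolution:
  "(\<Sum>j\<le>n. sqrt_coeff j * sqrt_coeff (n - j)) = (if n = 0 then 1 else if n = 1 then - 1 else 0)"
proof -
  have "fps_binomial (1/2) * fps_binomial (1/2) = (1 + fps_X :: real fps)"
    by (simp add: fps_binomial_1 flip: fps_binomial_add_mult)
  then have "fps_nth (fps_binomial (1/2) * fps_binomial (1/2)) n = fps_nth (1 + fps_X :: real fps) n"
    by simp
  then have "(\<Sum>j\<le>n. (1/2 gchoose j) * (1/2 gchoose (n - j))) = (if n = 0 then 1 else if n = 1 then 1 else (0::real))"
    by (simp add: fps_mult_nth atLeast0AtMost fps_X_def split: if_splits)
  moreover have "(\<Sum>j\<le>n. sqrt_coeff j * sqrt_coeff (n - j))
      = (\<Sum>j\<le>n. (-1) ^ n * ((1/2 gchoose j) * (1/2 gchoose (n - j))))"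
  proof (rule sum.cong[OF refl])
    fix j assume "j \<in> {..n}"
    then have "(-1::real) ^ n = (-1) ^ j * (-1) ^ (n - j)"
      by (simp flip: power_add)
    then show "sqrt_coeff j * sqrt_coeff (n - j) = (-1) ^ n * ((1/2 gchoose j) * (1/2 gchoose (n - j)))"
      by (simp add: sqrt_coeff_def)
  qed
  ultimately show ?thesis
    by (simp flip: sum_distrib_left)
qed

locale selfadjoint_contraction =
  fixes Z :: "'a::complex_hilbert \<Rightarrow> 'a"
  assumes selfadjoint: "bounded_selfadjoint Z" and contraction: "norm (Z x) \<le> norm x"
begin

text \<open>The square root of the identity minus \<open>Z\<close>, not of \<open>Z\<close>
  itself.\<close>

definition sqrt_op :: "'a \<Rightarrow> 'a" where
  "sqrt_op x = (\<Sum>k. sqrt_coeff k *\<^sub>R (Z ^^ k) x)"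

lemma norm_funpow_le: "norm ((Z ^^ k) x) \<le> norm x"
  by (induction k) (auto intro: order_trans contraction)

lemma bounded_selfadjoint_funpow: "bounded_selfadjoint (Z ^^ k)"
proof (induction k)
  case 0
  then show ?case
    by (auto intro!: bounded_selfadjointI bounded_linear_ident simp: id_def)
next
  case (Suc k)
  note Z = bounded_selfadjointD[OF selfadjoint] and IH = bounded_selfadjointD[OF Suc]
  show ?case
    by (intro bounded_selfadjointI)
      (auto simp: Z IH funpow_swap1 o_def intro: bounded_linear_compose[OF IH(1) Z(1)])
qed

lemma summable_norm: "summable (\<lambda>k. norm (sqrt_coeff k *\<^sub>R (Z ^^ k) x))"
proof (rule summable_comparison_test')
  show "summable (\<lambda>k. \<bar>sqrt_coeff k\<bar> * norm x)"
    by (intro summable_mult2 summable_abs_sqrt_coeff)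
  show "norm (norm (sqrt_coeff k *\<^sub>R (Z ^^ k) x)) \<le> \<bar>sqrt_coeff k\<bar> * norm x" for k
    by (simp add: mult_left_mono norm_funpow_le)
qed

lemma sqrt_op_sums: "(\<lambda>k. sqrt_coeff k *\<^sub>R (Z ^^ k) x) sums sqrt_op x"
  unfolding sqrt_op_def by (intro summable_sums summable_norm_cancel[OF summable_norm])

text \<open>A continuous linear map commuting with \<open>Z\<close> commutes with its powers and
  passes through the series. As \<open>C\<close> is only real linear and bounded, scalar
  multiplications are instances, which yields homogeneity of \<open>sqrt_op\<close>.\<close>

lemma sqrt_op_commute:
  assumes C: "bounded_linear C" and comm: "\<And>x. C (Z x) = Z (C x)"
  shows "C (sqrt_op x) = sqrt_op (C x)"
proof -
  interpret C: bounded_linear C by (rule C)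
  have "C ((Z ^^ k) x) = (Z ^^ k) (C x)" for k
    by (induction k) (simp_all add: comm)
  then have "(\<lambda>k. sqrt_coeff k *\<^sub>R (Z ^^ k) (C x)) sums C (sqrt_op x)"
    using C.sums[OF sqrt_op_sums[of x]] by (simp add: C.scaleR)
  then show ?thesis
    using sqrt_op_sums sums_unique2 by blast
qed

lemma bounded_selfadjoint_sqrt_op: "bounded_selfadjoint sqrt_op"
proof (rule bounded_selfadjointI)
  note pow = bounded_selfadjointD[OF bounded_selfadjoint_funpow]
  have lin: "linear (Z ^^ k)" for k
    using pow(1) bounded_linear.linear by blast
  show "sqrt_op (c *\<^sub>C x) = c *\<^sub>C sqrt_op x" for c x
    by (rule sqrt_op_commute[OF bounded_linear_scaleC, symmetric])
      (simp add: bounded_selfadjointD[OF selfadjoint])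
  show "bounded_linear sqrt_op"
  proof (rule bounded_linear_intro)
    show "sqrt_op (x + y) = sqrt_op x + sqrt_op y" for x y
      using sums_unique2[OF sqrt_op_sums[of "x + y"]] sums_add[OF sqrt_op_sums[of x] sqrt_op_sums[of y]]
      by (simp add: linear_add[OF lin] scaleR_add_right)
    show "sqrt_op (r *\<^sub>R x) = r *\<^sub>R sqrt_op x" for r x
      by (rule sqrt_op_commute[OF bounded_linear_scaleR_right, symmetric])
        (simp add: linear_scale[OF bounded_linear.linear[OF bounded_selfadjointD(1)[OF selfadjoint]]])
    show "norm (sqrt_op x) \<le> norm x * 2" for x
    proof (rule LIMSEQ_le_const2)
      show "(\<lambda>n. norm (\<Sum>k<n. sqrt_coeff k *\<^sub>R (Z ^^ k) x)) \<longlonglongrightarrow> norm (sqrt_op x)"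
        using sqrt_op_sums[of x] by (intro tendsto_norm) (simp add: sums_def)
      have "norm (\<Sum>k<n. sqrt_coeff k *\<^sub>R (Z ^^ k) x) \<le> norm x * 2" for n
      proof -
        have "norm (\<Sum>k<n. sqrt_coeff k *\<^sub>R (Z ^^ k) x) \<le> (\<Sum>k<n. \<bar>sqrt_coeff k\<bar> * norm x)"
          by (rule sum_norm_le) (simp add: mult_left_mono norm_funpow_le)
        also have "\<dots> \<le> 2 * norm x"
          unfolding sum_distrib_right[symmetric] by (intro mult_right_mono sum_abs_sqrt_coeff_le) simp
        finally show ?thesis by simp
      qed
      then show "\<exists>N. \<forall>n\<ge>N. norm (\<Sum>k<n. sqrt_coeff k *\<^sub>R (Z ^^ k) x) \<le> norm x * 2"
        by blast
    qed
  qed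
  show "rinner (sqrt_op x) y = rinner x (sqrt_op y)" for x y
    using sums_unique2[OF bounded_linear.sums[OF rinner.bounded_linear_left sqrt_op_sums[of x], of y]]
      bounded_linear.sums[OF rinner.bounded_linear_right sqrt_op_sums[of y], of x]
    by (simp add: rinner_simps pow)
qed

text \<open>The form of \<open>Z ^^ k\<close> is at most \<open>(norm x)\<^sup>2\<close> and the
  coefficients with \<open>k > 0\<close> are nonpositive, so each partial sum is at least
  \<open>(norm x)\<^sup>2\<close> times a partial sum of coefficients, which is nonnegative.\<close>

lemma sqrt_op_nonneg: "0 \<le> rinner (sqrt_op x) x"
proof (rule LIMSEQ_le_const)
  show "(\<lambda>n. \<Sum>k\<le>n. sqrt_coeff k * rinner ((Z ^^ k) x) x) \<longlonglongrightarrow> rinner (sqrt_op x) x"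
    using bounded_linear.sums[OF rinner.bounded_linear_left sqrt_op_sums[of x], of x]
    by (simp add: rinner_scaleR_left sums_def_le)
  have "0 \<le> (\<Sum>k\<le>n. sqrt_coeff k * rinner ((Z ^^ k) x) x)" for n
  proof -
    have "0 \<le> (\<Sum>k\<le>n. sqrt_coeff k * (norm x)\<^sup>2)"
      unfolding sum_distrib_right[symmetric] by (simp add: sum_sqrt_coeff_nonneg)
    also have "\<dots> \<le> (\<Sum>k\<le>n. sqrt_coeff k * rinner ((Z ^^ k) x) x)"
    proof (rule sum_mono)
      fix k
      have "rinner ((Z ^^ k) x) x \<le> norm ((Z ^^ k) x) * norm x"
        using rinner_le_norm[of "(Z ^^ k) x" x] by simp
      also have "\<dots> \<le> (norm x)\<^sup>2"
        by (simp add: power2_eq_square mult_right_mono norm_funpow_le)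
      finally show "sqrt_coeff k * (norm x)\<^sup>2 \<le> sqrt_coeff k * rinner ((Z ^^ k) x) x"
        using sqrt_coeff_nonpos[of k] by (cases "k = 0") (simp_all add: rinner_self mult_left_mono_neg)
    qed
    finally show ?thesis .
  qed
  then show "\<exists>N. \<forall>n\<ge>N. 0 \<le> (\<Sum>k\<le>n. sqrt_coeff k * rinner ((Z ^^ k) x) x)"
    by blast
qed

text \<open>Cauchy product of the series with itself. Absolute summability of the double family
  permits summation along antidiagonals, where the convolution of the coefficients leaves only the
  terms of degree 0 and 1.\<close>

lemma sqrt_op_square: "sqrt_op (sqrt_op x) = x - Z x"
proof -
  define f where "f = (\<lambda>(j, k). (sqrt_coeff j * sqrt_coeff k) *\<^sub>R (Z ^^ (j + k)) x)"
  have op_infsum: "(\<Sum>\<^sub>\<infinity>k. sqrt_coeff k *\<^sub>R (Z ^^ k) y) = sqrt_op y" for y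
    by (intro infsumI norm_summable_imp_has_sum summable_norm sqrt_op_sums)
  \<comment> \<open>A finite set of index pairs lies in a square, over which the sum of the bounds
    factors into two absolute coefficient sums, each at most 2.\<close>
  have "(\<lambda>p. norm (f p)) summable_on UNIV"
  proof (rule nonneg_bdd_above_summable_on)
    show "bdd_above (sum (\<lambda>p. norm (f p)) ` {F. F \<subseteq> UNIV \<and> finite F})"
    proof (rule bdd_aboveI2)
      fix F :: "(nat \<times> nat) set" assume "F \<in> {F. F \<subseteq> UNIV \<and> finite F}"
      then have "finite (fst ` F \<union> snd ` F)"
        by simp
      then obtain n where "fst ` F \<union> snd ` F \<subseteq> {..<n}"
        using finite_nat_iff_bounded by blast
      then have "F \<subseteq> {..<n} \<times> {..<n}"
        by force
      then have "sum (\<lambda>p. norm (f p)) F \<le> (\<Sum>p\<in>{..<n} \<times> {..<n}. norm (f p))"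
        by (intro sum_mono2) auto
      also have "\<dots> \<le> (\<Sum>(j, k)\<in>{..<n} \<times> {..<n}. \<bar>sqrt_coeff j\<bar> * \<bar>sqrt_coeff k\<bar> * norm x)"
        by (rule sum_mono) (auto simp: f_def abs_mult mult_left_mono norm_funpow_le)
      also have "\<dots> = (\<Sum>j<n. \<bar>sqrt_coeff j\<bar>) * (\<Sum>k<n. \<bar>sqrt_coeff k\<bar>) * norm x"
        by (subst sum_product, subst sum.cartesian_product) (simp add: sum_distrib_right split_def)
      also have "\<dots> \<le> 2 * 2 * norm x"
        by (intro mult_mono mult_right_mono sum_abs_sqrt_coeff_le mult_nonneg_nonneg sum_nonneg) auto
      finally show "sum (\<lambda>p. norm (f p)) F \<le> 2 * 2 * norm x" .
    qed
  qed simp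
  then have sf: "f summable_on UNIV"
    by (rule abs_summable_summable)
  have "sqrt_op (sqrt_op x) = (\<Sum>\<^sub>\<infinity>j. \<Sum>\<^sub>\<infinity>k. f (j, k))"
  proof -
    have "(\<Sum>\<^sub>\<infinity>k. f (j, k)) = sqrt_coeff j *\<^sub>R (Z ^^ j) (sqrt_op x)" for j
    proof -
      note pow = bounded_selfadjointD(1)[OF bounded_selfadjoint_funpow, of j]
      have "((\<lambda>k. sqrt_coeff k *\<^sub>R (Z ^^ k) x) has_sum sqrt_op x) UNIV"
        by (intro norm_summable_imp_has_sum summable_norm sqrt_op_sums)
      then have "((\<lambda>k. sqrt_coeff j *\<^sub>R (Z ^^ j) (sqrt_coeff k *\<^sub>R (Z ^^ k) x)) has_sum
          sqrt_coeff j *\<^sub>R (Z ^^ j) (sqrt_op x)) UNIV"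
        by (intro has_sum_bounded_linear[OF bounded_linear_compose[OF bounded_linear_scaleR_right pow], unfolded o_def])
      then show ?thesis
        by (intro infsumI) (simp add: f_def linear_scale[OF bounded_linear.linear[OF pow]] funpow_add)
    qed
    then show ?thesis
      by (simp add: op_infsum)
  qed
  also have "\<dots> = infsum f (UNIV \<times> UNIV)"
    using infsum_Sigma_banach[of f UNIV "\<lambda>_. UNIV"] sf by simp
  also have "\<dots> = (\<Sum>\<^sub>\<infinity>(n, j)\<in>Sigma UNIV (\<lambda>n. {..n}). f (j, n - j))"
  proof -
    \<comment> \<open>Here \<open>n\<close> numbers the antidiagonal \<open>j + k = n\<close>, and
      \<open>j\<close> the position on it.\<close>
    have "bij_betw (\<lambda>(n, j). (j, n - j)) (Sigma UNIV (\<lambda>n::nat. {..n})) (UNIV \<times> UNIV)"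
      by (rule bij_betwI[where g = "\<lambda>(j, k). (j + k, j)"]) auto
    from infsum_reindex_bij_betw[OF this, of f] show ?thesis
      by (simp add: split_def)
  qed
  also have "\<dots> = (\<Sum>\<^sub>\<infinity>n. \<Sum>\<^sub>\<infinity>j\<in>{..n}. f (j, n - j))"
  proof -
    have "bij_betw (\<lambda>(n, j). (j, n - j)) (Sigma UNIV (\<lambda>n::nat. {..n})) (UNIV \<times> UNIV)"
      by (rule bij_betwI[where g = "\<lambda>(j, k). (j + k, j)"]) auto
    from summable_on_reindex_bij_betw[OF this, of f] sf
    have "(\<lambda>(n, j). f (j, n - j)) summable_on Sigma UNIV (\<lambda>n::nat. {..n})"
      by (simp add: split_def)
    then show ?thesis
      using infsum_Sigma_banach by fastforce
  qed
  also have "\<dots> = (\<Sum>\<^sub>\<infinity>n::nat. if n = 0 then x else if n = 1 then - Z x else 0)"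
  proof (rule infsum_cong)
    fix n :: nat
    have "(\<Sum>\<^sub>\<infinity>j\<in>{..n}. f (j, n - j)) = (\<Sum>j\<le>n. sqrt_coeff j * sqrt_coeff (n - j)) *\<^sub>R (Z ^^ n) x"
      by (simp add: f_def scaleR_sum_left)
    also have "\<dots> = (if n = 0 then x else if n = 1 then - Z x else 0)"
      by (simp add: sqrt_coeff_convolution)
    finally show "(\<Sum>\<^sub>\<infinity>j\<in>{..n}. f (j, n - j)) = (if n = 0 then x else if n = 1 then - Z x else 0)" .
  qed
  also have "\<dots> = (\<Sum>\<^sub>\<infinity>n\<in>{0, 1::nat}. if n = 0 then x else if n = 1 then - Z x else 0)"
    by (rule infsum_cong_neutral) auto
  also have "\<dots> = x - Z x"
    by simp
  finally show ?thesis .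
qed

end

text \<open>Rescale \<open>T\<close> to a contraction \<open>S\<close> and put
  \<open>Z = 1 - S\<^sup>2\<close>. Then \<open>sqrt_op\<close> is the root of
  \<open>S\<^sup>2\<close>, and \<open>K\<close> times it is the absolute value of \<open>T\<close>.
  The commutation clause is what later makes the projections cut out by \<open>R\<close> commute
  with everything relevant.\<close>

lemma absolute_value_exists:
  fixes T :: "'a::complex_hilbert \<Rightarrow> 'a"
  assumes T: "bounded_selfadjoint T"
  shows "\<exists>R. bounded_selfadjoint R \<and> (\<forall>x. R (R x) = T (T x)) \<and> (\<forall>x. 0 \<le> rinner (R x) x) \<and>
    (\<forall>C x. bounded_linear C \<longrightarrow> (\<forall>y. C (T y) = T (C y)) \<longrightarrow> C (R x) = R (C x))"
proof -
  note T = bounded_selfadjointD[OF T]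
  interpret T: bounded_linear T by (rule T)
  obtain K where "K > 0" and K: "\<And>x. norm (T x) \<le> norm x * K"
    using T.pos_bounded by blast
  define S where "S = (\<lambda>x. (1/K) *\<^sub>R T x)"
  define Z where "Z = (\<lambda>x. x - S (S x))"
  have "bounded_selfadjoint S"
    unfolding S_def
    by (rule bounded_selfadjointI) (auto intro!: bounded_linear_const_scaleR T(1) simp: T rinner_simps scaleC_scaleR)
  note S = bounded_selfadjointD[OF this]
  interpret S: bounded_linear S by (rule S)
  have le: "norm (S x) \<le> norm x" for x
    using K[of x] \<open>K > 0\<close> by (simp add: S_def field_simps)
  interpret selfadjoint_contraction Z
  proof
    show "bounded_selfadjoint Z"
      unfolding Z_def
      by (rule bounded_selfadjointI)
        (auto intro!: bounded_linear_sub bounded_linear_ident bounded_linear_compose[OF S(1)] S(1)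
          simp: S rinner_simps scaleC_diff_right)
    show "norm (Z x) \<le> norm x" for x
    proof (rule power2_le_imp_le)
      \<comment> \<open>Since \<open>S\<close> is a self-adjoint contraction, the last term costs at
        most half of what the middle term gains.\<close>
      have "(norm (Z x))\<^sup>2 = (norm x)\<^sup>2 - 2 * (norm (S x))\<^sup>2 + (norm (S (S x)))\<^sup>2"
        unfolding Z_def norm_diff_sq by (simp add: rinner_self flip: S(3))
      moreover have "(norm (S (S x)))\<^sup>2 \<le> (norm (S x))\<^sup>2"
        using le[of "S x"] by (rule power_mono) simp
      ultimately show "(norm (Z x))\<^sup>2 \<le> (norm x)\<^sup>2"
        using zero_le_power2[of "norm (S x)"] by linarith
    qed simp
  qed
  note sq = bounded_selfadjointD[OF bounded_selfadjoint_sqrt_op]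
  interpret sq: bounded_linear sqrt_op by (rule sq)
  show ?thesis
  proof (intro exI conjI allI impI)
    show "bounded_selfadjoint (\<lambda>x. K *\<^sub>R sqrt_op x)"
      by (rule bounded_selfadjointI)
        (auto intro!: bounded_linear_const_scaleR sq(1) simp: sq rinner_simps scaleC_scaleR)
    show "K *\<^sub>R sqrt_op (K *\<^sub>R sqrt_op x) = T (T x)" for x
    proof -
      have "K *\<^sub>R sqrt_op (K *\<^sub>R sqrt_op x) = (K * K) *\<^sub>R (x - Z x)"
        by (simp only: sq.scaleR scaleR_scaleR sqrt_op_square)
      then show ?thesis
        using \<open>K > 0\<close> by (simp add: Z_def S_def T.scaleR)
    qed
    show "0 \<le> rinner (K *\<^sub>R sqrt_op x) x" for x
      using \<open>K > 0\<close> sqrt_op_nonneg[of x] by (simp add: rinner_simps)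
    show "C (K *\<^sub>R sqrt_op x) = K *\<^sub>R sqrt_op (C x)"
      if C: "bounded_linear C" and comm: "\<forall>y. C (T y) = T (C y)" for C x
    proof -
      interpret C: bounded_linear C by (rule C)
      have "C (Z y) = Z (C y)" for y
        by (simp add: Z_def S_def C.diff C.scaleR comm T.scaleR)
      then show ?thesis
        by (simp add: C.scaleR sqrt_op_commute[OF C])
    qed
  qed
qed

section \<open>The resolution of the identity\<close>

text \<open>Moving from \<open>z\<close> a small step \<open>t\<close> in the direction of
  \<open>- R z\<close> changes the form by \<open>t * (t * c - 2 * a)\<close>, which would be
  negative if \<open>R z\<close> were nonzero.\<close>

lemma kernel_of_nonneg_form:
  assumes R: "bounded_selfadjoint R" and nonneg: "\<And>x. 0 \<le> rinner (R x) x"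
    and zero: "rinner (R z) z = 0"
  shows "R z = 0"
proof (rule ccontr)
  assume "R z \<noteq> 0"
  note R = bounded_selfadjointD[OF R]
  interpret R: bounded_linear R by (rule R)
  define a where "a = (norm (R z))\<^sup>2"
  define c where "c = rinner (R (R z)) (R z)"
  \<comment> \<open>Chosen so that \<open>t * c < a\<close>; the added 1 covers the case
    \<open>c = 0\<close>.\<close>
  define t where "t = a / (c + 1)"
  have "a > 0" "c \<ge> 0"
    using \<open>R z \<noteq> 0\<close> nonneg by (auto simp: a_def c_def)
  then have "t > 0"
    by (simp add: t_def)
  have "0 \<le> rinner (R (z - t *\<^sub>R R z)) (z - t *\<^sub>R R z)"
    by (rule nonneg)
  also have "\<dots> = t * (t * c - 2 * a)"
    using R(3)[of "R z" z] zero
    by (simp add: R.diff R.scaleR rinner_simps a_def c_def rinner_self algebra_simps)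
  finally have "2 * a \<le> t * c"
    using \<open>t > 0\<close> by (simp add: zero_le_mult_iff)
  also have "t * c < a"
    using \<open>a > 0\<close> \<open>c \<ge> 0\<close> by (simp add: t_def field_simps)
  finally show False
    using \<open>a > 0\<close> by simp
qed

text \<open>Invariance says \<open>C P = P C P\<close>; the right-hand side is self-adjoint, so
  \<open>C P\<close> equals its adjoint \<open>P C\<close>.\<close>

lemma invariant_range_commute:
  assumes P: "orthogonal_projection P" and C: "bounded_selfadjoint C"
    and inv: "\<And>x. P x = x \<Longrightarrow> P (C x) = C x"
  shows "C (P x) = P (C x)"
proof -
  note P' = bounded_selfadjointD[OF orthogonal_projectionD(1)[OF P]] and C = bounded_selfadjointD[OF C]
  have PCP: "P (C (P y)) = C (P y)" for y
    by (rule inv) (rule orthogonal_projectionD(2)[OF P])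
  have "rinner (P (C x)) y = rinner (C (P x)) y" for y
  proof -
    have "rinner (P (C x)) y = rinner x (C (P y))"
      by (simp add: P' C)
    also have "\<dots> = rinner x (P (C (P y)))"
      by (simp add: PCP)
    also have "\<dots> = rinner (P (C (P x))) y"
      by (simp only: P'(3) C(3))
    finally show ?thesis
      by (simp add: PCP)
  qed
  then have "rinner (P (C x) - C (P x)) (P (C x) - C (P x)) = 0"
    by (simp add: rinner.diff_left)
  then show ?thesis
    by (simp add: rinner_self)
qed

text \<open>Describes the spectral projection of \<open>T\<close> for the half-line up to and
  including 0 by means of the quadratic form alone. The last clause puts the kernel of
  \<open>T\<close> into the range of \<open>P\<close>; it is the source of monotonicity and right
  continuity of the resolution.\<close>

definition negative_projection :: "('a::complex_inner \<Rightarrow> 'a) \<Rightarrow> ('a \<Rightarrow> 'a) \<Rightarrow> bool" where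
  "negative_projection T P \<longleftrightarrow> orthogonal_projection P \<and>
    (\<forall>C x. bounded_selfadjoint C \<longrightarrow> (\<forall>y. C (T y) = T (C y)) \<longrightarrow> C (P x) = P (C x)) \<and>
    (\<forall>x. P x = x \<longrightarrow> rinner (T x) x \<le> 0) \<and>
    (\<forall>x. P x = 0 \<longrightarrow> 0 \<le> rinner (T x) x) \<and>
    (\<forall>x. P x = 0 \<longrightarrow> rinner (T x) x \<le> 0 \<longrightarrow> x = 0)"

lemma negative_projection_exists:
  fixes T :: "'a::complex_hilbert \<Rightarrow> 'a"
  assumes T: "bounded_selfadjoint T"
  shows "\<exists>P. negative_projection T P"
proof -
  note T' = bounded_selfadjointD[OF T]
  interpret T: bounded_linear T by (rule T')
  obtain R where R: "bounded_selfadjoint R" and sq: "\<And>x. R (R x) = T (T x)"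
    and nonneg: "\<And>x. 0 \<le> rinner (R x) x"
    and comm: "\<And>C x. bounded_linear C \<Longrightarrow> (\<And>y. C (T y) = T (C y)) \<Longrightarrow> C (R x) = R (C x)"
    using absolute_value_exists[OF T] by blast
  note R' = bounded_selfadjointD[OF R]
  interpret R: bounded_linear R by (rule R')
  have TR: "T (R x) = R (T x)" for x
    using comm[OF T'(1)] by simp
  define M where "M = {x. R x + T x = 0}"
  have "closed M"
    unfolding M_def by (intro closed_Collect_eq continuous_intros linear_continuous_on R' T')
  moreover have "csubspace M"
    unfolding csubspace_def M_def
  proof (safe, goal_cases)
    case 1
    show ?case by (simp add: R.zero T.zero)
  next
    case (2 x y)
    then have "(R x + T x) + (R y + T y) = 0"
      by simp
    then show ?case
      by (simp add: R.add T.add algebra_simps)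
  next
    case (3 c x)
    then show ?case
      by (simp add: R' T' scaleC_zero_right flip: scaleC_add_right)
  qed
  ultimately obtain P where P: "orthogonal_projection P" and "range P = M"
    and orth: "\<And>x z. z \<in> M \<Longrightarrow> rinner (x - P x) z = 0"
    by (rule projection_exists) blast
  then have M_iff: "P x = x \<longleftrightarrow> R x + T x = 0" for x
    using range_projection[OF P, of x] by (simp add: M_def)
  have R_eq_T: "R x = T x" if "P x = 0" for x
  proof -
    \<comment> \<open>Because \<open>R\<close> and \<open>T\<close> commute and have equal squares,
      \<open>(R + T) (R - T) = 0\<close>. So the range of \<open>R - T\<close> lies in
      \<open>M\<close>, and a vector orthogonal to \<open>M\<close> is killed by the self-adjoint
      \<open>R - T\<close>.\<close>
    have "R (R y - T y) + T (R y - T y) = 0" for y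
      by (simp add: R.diff T.diff sq TR)
    then have "rinner x (R y - T y) = 0" for y
      using orth[of "R y - T y" x] that by (simp add: M_def)
    then have "rinner (R x - T x) (R x - T x) = 0"
      by (simp add: rinner_simps R' T')
    then show ?thesis
      by (simp add: rinner_self)
  qed
  have "C (P x) = P (C x)" if C: "bounded_selfadjoint C" and CT: "\<forall>y. C (T y) = T (C y)" for C x
  proof (rule invariant_range_commute[OF P C])
    interpret C: bounded_linear C using bounded_selfadjointD(1)[OF C] .
    fix x assume "P x = x"
    then have "C (R x + T x) = 0"
      by (simp add: M_iff C.zero)
    then show "P (C x) = C x"
      using comm[OF bounded_selfadjointD(1)[OF C], of x] CT by (simp add: M_iff C.add)
  qed
  moreover have "rinner (T x) x \<le> 0" if "P x = x" for x
  proof -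
    have "T x = - R x"
      using that by (simp add: M_iff eq_neg_iff_add_eq_0 add.commute)
    then show ?thesis
      using nonneg[of x] by (simp add: rinner.minus_left)
  qed
  moreover have "0 \<le> rinner (T x) x" if "P x = 0" for x
    using R_eq_T[OF that] nonneg[of x] by simp
  \<comment> \<open>On such \<open>x\<close> the form of \<open>R\<close> vanishes, so
    \<open>R x = T x = 0\<close>. Then \<open>x\<close> lies in \<open>M\<close> and is also
    orthogonal to it.\<close>
  moreover have "x = 0" if "P x = 0" "rinner (T x) x \<le> 0" for x
  proof -
    have "R x = 0"
      using kernel_of_nonneg_form[OF R nonneg, of x] R_eq_T[OF that(1)] that(2) nonneg[of x] by simp
    then show ?thesis
      using that(1) R_eq_T[OF that(1)] M_iff[of x] by simp
  qed
  ultimately show ?thesis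
    using P unfolding negative_projection_def by blast
qed

lemma norm_sum_orthogonal_projections:
  assumes P: "\<And>n. orthogonal_projection (P n)" and orth: "\<And>m n x. m \<noteq> n \<Longrightarrow> P m (P n x) = 0"
  shows "(norm (\<Sum>n\<in>I. P n x))\<^sup>2 = (\<Sum>n\<in>I. (norm (P n x))\<^sup>2)"
    and "norm (\<Sum>n\<in>I. P n x) \<le> norm x"
proof -
  have cross: "rinner (P m x) (P n x) = (if m = n then (norm (P n x))\<^sup>2 else 0)" for m n
  proof (cases "m = n")
    case False
    then have "rinner (P m x) (P n x) = rinner x 0"
      by (simp only: bounded_selfadjointD(3)[OF orthogonal_projectionD(1)[OF P]] orth[OF False])
    with False show ?thesis
      by (simp add: rinner.zero_right)
  qed (simp add: rinner_self)
  show *: "(norm (\<Sum>n\<in>I. P n x))\<^sup>2 = (\<Sum>n\<in>I. (norm (P n x))\<^sup>2)"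
  proof (cases "finite I")
    case True
    then have "rinner (\<Sum>n\<in>I. P n x) (\<Sum>n\<in>I. P n x) = (\<Sum>n\<in>I. (norm (P n x))\<^sup>2)"
      by (simp add: rinner.sum_left rinner.sum_right cross)
    then show ?thesis
      by (simp add: rinner_self)
  qed simp
  have "(\<Sum>n\<in>I. (norm (P n x))\<^sup>2) = rinner (\<Sum>n\<in>I. P n x) x"
    by (simp add: rinner.sum_left rinner_projection[OF P])
  then have "(norm (\<Sum>n\<in>I. P n x))\<^sup>2 \<le> norm (\<Sum>n\<in>I. P n x) * norm x"
    using * rinner_le_norm[of "\<Sum>n\<in>I. P n x" x] by linarith
  then show "norm (\<Sum>n\<in>I. P n x) \<le> norm x"
    by (metis mult_le_cancel_left_pos norm_ge_zero order_le_less power2_eq_square)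
qed

text \<open>By Pythagoras the blocks of the series have squared norms equal to blocks of a real
  series bounded by \<open>(norm x)\<^sup>2\<close>, which makes the series Cauchy.\<close>

lemma orthogonal_projections_sums:
  fixes P :: "nat \<Rightarrow> 'a::complex_hilbert \<Rightarrow> 'a"
  assumes P: "\<And>n. orthogonal_projection (P n)" and orth: "\<And>m n x. m \<noteq> n \<Longrightarrow> P m (P n x) = 0"
  obtains Q where "orthogonal_projection Q" and "\<And>x. (\<lambda>n. P n x) sums Q x"
proof -
  note pyth = norm_sum_orthogonal_projections[where P = P, OF P orth]
  note sa = bounded_selfadjointD[OF orthogonal_projectionD(1)[OF P]]
  have lin: "linear (P n)" for n
    using sa(1) bounded_linear.linear by blast
  have "summable (\<lambda>n. P n x)" for x
    unfolding summable_Cauchy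
  proof safe
    fix e :: real assume "e > 0"
    have "summable (\<lambda>n. (norm (P n x))\<^sup>2)"
    proof (rule summableI_nonneg_bounded)
      show "(\<Sum>k<n. (norm (P k x))\<^sup>2) \<le> (norm x)\<^sup>2" for n
        using power_mono[OF pyth(2)[where x = x and I = "{..<n}"], where n = 2] by (simp add: pyth(1))
    qed simp
    then obtain N where N: "\<And>m n. m \<ge> N \<Longrightarrow> norm (\<Sum>k = m..<n. (norm (P k x))\<^sup>2) < e\<^sup>2"
      using \<open>e > 0\<close> unfolding summable_Cauchy by (metis zero_less_power)
    have "norm (\<Sum>k = m..<n. P k x) < e" if "m \<ge> N" for m n
    proof (rule power2_less_imp_less)
      show "(norm (\<Sum>k = m..<n. P k x))\<^sup>2 < e\<^sup>2"
        using N[OF that, of n] by (simp add: pyth(1) abs_of_nonneg sum_nonneg)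
    qed (use \<open>e > 0\<close> in simp)
    then show "\<exists>N. \<forall>m\<ge>N. \<forall>n. norm (\<Sum>k = m..<n. P k x) < e"
      by blast
  qed
  define Q where "Q = (\<lambda>x. \<Sum>n. P n x)"
  have sums: "(\<lambda>n. P n x) sums Q x" for x
    unfolding Q_def by (intro summable_sums \<open>summable (\<lambda>n. P n x)\<close>)
  have "norm (Q x) \<le> norm x" for x
  proof (rule LIMSEQ_le_const2)
    show "(\<lambda>n. norm (\<Sum>k<n. P k x)) \<longlonglongrightarrow> norm (Q x)"
      using sums[of x] by (intro tendsto_norm) (simp add: sums_def)
    show "\<exists>N. \<forall>n\<ge>N. norm (\<Sum>k<n. P k x) \<le> norm x"
      using pyth(2) by blast
  qed
  moreover have "Q (x + y) = Q x + Q y" for x y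
    using sums_unique2[OF sums[of "x + y"]] sums_add[OF sums[of x] sums[of y]]
    by (simp add: linear_add[OF lin])
  moreover have "Q (r *\<^sub>R x) = r *\<^sub>R Q x" for r x
    using sums_unique2[OF sums[of "r *\<^sub>R x"]] bounded_linear.sums[OF bounded_linear_scaleR_right sums[of x], of r]
    by (simp add: linear_scale[OF lin])
  ultimately have "bounded_linear Q"
    by (intro bounded_linear_intro[of _ 1]) auto
  moreover have "Q (c *\<^sub>C x) = c *\<^sub>C Q x" for c x
    using sums_unique2[OF sums[of "c *\<^sub>C x"]] bounded_linear.sums[OF bounded_linear_scaleC sums[of x], of c]
    by (simp add: sa)
  moreover have "rinner (Q x) y = rinner x (Q y)" for x y
    using sums_unique2[OF bounded_linear.sums[OF rinner.bounded_linear_left sums[of x], of y]]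
      bounded_linear.sums[OF rinner.bounded_linear_right sums[of y], of x]
    by (simp add: sa)
  ultimately have "bounded_selfadjoint Q"
    by (rule bounded_selfadjointI)
  moreover have "Q (Q x) = Q x" for x
  proof -
    \<comment> \<open>Orthogonality leaves a single term of the series. Summing over
      \<open>m\<close> then gives idempotence of \<open>Q\<close>.\<close>
    have "P m (Q x) = P m x" for m
    proof -
      have "(\<lambda>n. P m (P n x)) sums P m (Q x)"
        by (rule bounded_linear.sums[OF sa(1) sums])
      moreover have "(\<lambda>n. P m (P n x)) = (\<lambda>n. if n = m then P n x else 0)"
        using orth orthogonal_projectionD(2)[OF P] by fastforce
      ultimately show ?thesis
        using sums_unique2[OF _ sums_single[of m "\<lambda>n. P n x"]] by simp
    qed
    then show ?thesis
      by (simp add: Q_def)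
  qed
  ultimately have "orthogonal_projection Q"
    by (auto simp: orthogonal_projection_def)
  then show thesis
    using that sums by blast
qed

text \<open>Over a partition into equal pieces the increments of \<open>p\<close> add up to at most
  the mesh times \<open>F b - F a\<close>, and the mesh tends to 0.\<close>

lemma eq_if_variation_dominated:
  fixes p F :: "real \<Rightarrow> real"
  assumes "a \<le> b"
    and le: "\<And>s t. a \<le> s \<Longrightarrow> s \<le> t \<Longrightarrow> t \<le> b \<Longrightarrow> \<bar>p t - p s\<bar> \<le> (t - s) * (F t - F s)"
  shows "p b = p a"
proof -
  have bound: "\<bar>p b - p a\<bar> \<le> (b - a) * (F b - F a) / Suc n" for n
  proof -
    define u where "u k = a + k * (b - a) / Suc n" for k :: nat
    have step: "u (Suc k) - u k = (b - a) / Suc n" for k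
      by (simp add: u_def algebra_simps add_divide_distrib diff_divide_distrib)
    have ends: "u 0 = a" "u (Suc n) = b"
      using nonzero_mult_div_cancel_left[of "real (Suc n)" "b - a"] by (simp_all add: u_def del: of_nat_Suc)
    have "\<bar>p b - p a\<bar> = \<bar>\<Sum>k<Suc n. p (u (Suc k)) - p (u k)\<bar>"
      by (simp only: sum_lessThan_telescope[of "\<lambda>k. p (u k)"] ends)
    also have "\<dots> \<le> (\<Sum>k<Suc n. \<bar>p (u (Suc k)) - p (u k)\<bar>)"
      by (rule sum_abs)
    also have "\<dots> \<le> (\<Sum>k<Suc n. (b - a) / Suc n * (F (u (Suc k)) - F (u k)))"
    proof (rule sum_mono)
      fix k assume "k \<in> {..<Suc n}"
      have "a \<le> u k"
        using \<open>a \<le> b\<close> by (simp add: u_def)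
      moreover have "u k \<le> u (Suc k)"
        using step[of k] \<open>a \<le> b\<close> by (smt (verit) divide_nonneg_nonneg of_nat_0_le_iff)
      moreover have "u (Suc k) \<le> b"
      proof -
        have "real (Suc k) * (b - a) \<le> real (Suc n) * (b - a)"
          using \<open>k \<in> {..<Suc n}\<close> \<open>a \<le> b\<close> by (intro mult_right_mono) auto
        then have "real (Suc k) * (b - a) / Suc n \<le> b - a"
          by (simp add: field_simps)
        then show ?thesis
          by (simp add: u_def)
      qed
      ultimately show "\<bar>p (u (Suc k)) - p (u k)\<bar> \<le> (b - a) / Suc n * (F (u (Suc k)) - F (u k))"
        using le[of "u k" "u (Suc k)"] step[of k] by simp
    qed
    also have "\<dots> = (b - a) / Suc n * (F b - F a)"
      by (simp only: sum_distrib_left[symmetric] sum_lessThan_telescope[of "\<lambda>k. F (u k)"] ends)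
    finally show ?thesis by simp
  qed
  have "(\<lambda>n. (b - a) * (F b - F a) * inverse (real (Suc n))) \<longlonglongrightarrow> (b - a) * (F b - F a) * 0"
    by (intro tendsto_mult_left LIMSEQ_inverse_real_of_nat)
  then have "\<bar>p b - p a\<bar> \<le> (b - a) * (F b - F a) * 0"
    by (rule LIMSEQ_le_const) (use bound in \<open>auto simp: field_simps\<close>)
  then show ?thesis
    by simp
qed

section \<open>Existence of the spectral measure\<close>

lemma bounded_selfadjoint_diff:
  assumes S: "bounded_selfadjoint S" and T: "bounded_selfadjoint T"
  shows "bounded_selfadjoint (\<lambda>x. S x - T x)"
proof -
  note S = bounded_selfadjointD[OF S] and T = bounded_selfadjointD[OF T]
  show ?thesis
    by (intro bounded_selfadjointI bounded_linear_sub S(1) T(1))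
      (simp_all add: S T rinner_simps scaleC_diff_right)
qed

lemma bounded_selfadjoint_scaleR: "bounded_selfadjoint (\<lambda>x. r *\<^sub>R x)"
  by (intro bounded_selfadjointI bounded_linear_scaleR_right) (simp_all add: rinner_simps scaleC_scaleR)

text \<open>\<open>measure_of\<close> takes the prescribed values only once the set function is
  known to be a measure. Countable additivity comes from strong convergence, tested against
  \<open>x\<close>.\<close>

lemma emeasure_scalar_measure:
  assumes E: "projection_valued_measure E" and S: "S \<in> sets borel"
  shows "emeasure (scalar_measure E x) S = ennreal (rinner (E S x) x)"
proof -
  have P: "orthogonal_projection (E S)" if "S \<in> sets borel" for S
    using E that by (simp add: projection_valued_measure_def)
  have zero: "E {} = (\<lambda>x. 0)"
    using E by (simp add: projection_valued_measure_def)
  have sums: "(\<lambda>n. E (F n) x) sums E (\<Union>n. F n) x"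
    if "range F \<subseteq> sets borel" "disjoint_family F" for F :: "nat \<Rightarrow> real set" and x
    using E that unfolding projection_valued_measure_def by blast
  show ?thesis
    unfolding scalar_measure_def rinner_def[symmetric]
  proof (rule emeasure_measure_of_sigma[OF _ _ _ S])
    show "sigma_algebra UNIV (sets (borel :: real measure))"
      using sets.sigma_algebra_axioms[of "borel :: real measure"] by simp
    show "positive (sets borel) (\<lambda>S. ennreal (rinner (E S x) x))"
      by (simp add: positive_def zero rinner.zero_left)
    show "countably_additive (sets borel) (\<lambda>S. ennreal (rinner (E S x) x))"
    proof (rule countably_additiveI)
      fix F :: "nat \<Rightarrow> real set"
      assume F: "range F \<subseteq> sets borel" "disjoint_family F"
      then have "0 \<le> rinner (E (F n) x) x" for n
        using rinner_projection[OF P, of "F n"] by (simp add: range_subsetD)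
      then show "(\<Sum>n. ennreal (rinner (E (F n) x) x)) = ennreal (rinner (E (\<Union>n. F n) x) x)"
        by (intro suminf_ennreal_eq bounded_linear.sums[OF rinner.bounded_linear_left sums[OF F]]) auto
    qed
  qed
qed

lemma sets_scalar_measure [simp, measurable_cong]: "sets (scalar_measure E x) = sets borel"
  unfolding scalar_measure_def
  by (metis sets.sigma_sets_eq sets_measure_of space_borel subset_UNIV Pow_UNIV)

lemma space_scalar_measure [simp]: "space (scalar_measure E x) = UNIV"
  by (simp add: scalar_measure_def space_measure_of_conv)

section \<open>The resolution of the identity and its distribution functions\<close>

locale selfadjoint_operator =
  fixes B :: "'a::complex_hilbert \<Rightarrow> 'a"
  assumes selfadjoint: "bounded_selfadjoint B"
begin

sublocale bounded_linear B
  using selfadjoint by (rule bounded_selfadjointD)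

definition resolution :: "real \<Rightarrow> 'a \<Rightarrow> 'a" where
  "resolution l = (SOME P. negative_projection (\<lambda>x. B x - l *\<^sub>R x) P)"

lemma negative_projection_resolution: "negative_projection (\<lambda>x. B x - l *\<^sub>R x) (resolution l)"
  unfolding resolution_def
  using someI_ex[OF negative_projection_exists[OF
    bounded_selfadjoint_diff[OF selfadjoint bounded_selfadjoint_scaleR]]] .

lemma resolution_projection: "orthogonal_projection (resolution l)"
  and resolution_upper: "resolution l x = x \<Longrightarrow> rinner (B x) x \<le> l * (norm x)\<^sup>2"
  and resolution_lower: "resolution l x = 0 \<Longrightarrow> l * (norm x)\<^sup>2 \<le> rinner (B x) x"
  and resolution_strict: "resolution l x = 0 \<Longrightarrow> rinner (B x) x \<le> l * (norm x)\<^sup>2 \<Longrightarrow> x = 0"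
  using negative_projection_resolution[of l]
  by (simp_all add: negative_projection_def rinner_simps rinner_self)

lemma resolution_commute:
  assumes C: "bounded_selfadjoint C" and comm: "\<And>y. C (B y) = B (C y)"
  shows "C (resolution l x) = resolution l (C x)"
proof -
  interpret C: bounded_linear C
    using bounded_selfadjointD(1)[OF C] .
  have "C (B y - l *\<^sub>R y) = B (C y) - l *\<^sub>R C y" for y
    by (simp add: C.diff C.scaleR comm)
  moreover have "\<forall>C x. bounded_selfadjoint C \<longrightarrow> (\<forall>y. C (B y - l *\<^sub>R y) = B (C y) - l *\<^sub>R C y) \<longrightarrow>
      C (resolution l x) = resolution l (C x)"
    using negative_projection_resolution[of l] unfolding negative_projection_def by (elim conjE)
  ultimately show ?thesis
    using C by simp
qed

lemmas resolution_selfadjoint = orthogonal_projectionD(1)[OF resolution_projection]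
lemmas resolution_idem = orthogonal_projectionD(2)[OF resolution_projection]
lemmas resolution_sym = bounded_selfadjointD(3)[OF resolution_selfadjoint]

lemma linear_resolution: "linear (resolution l)"
  using bounded_linear.linear[OF bounded_selfadjointD(1)[OF resolution_selfadjoint]] .

lemmas resolution_diff = linear_diff[OF linear_resolution]

lemma resolution_commute_B: "resolution l (B x) = B (resolution l x)"
  by (simp add: resolution_commute[OF selfadjoint])

lemma resolution_commute_resolution: "resolution l (resolution m x) = resolution m (resolution l x)"
  by (rule resolution_commute[OF resolution_selfadjoint resolution_commute_B])

text \<open>The part \<open>z\<close> of a vector in the range of \<open>resolution l\<close> that
  \<open>resolution m\<close> annihilates stays in that range by commutation. Its form is thus at
  most \<open>l \<le> m\<close> times its squared norm, and \<open>resolution_strict\<close> forces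
  \<open>z = 0\<close>.\<close>

lemma resolution_mono:
  assumes "l \<le> m"
  shows "resolution m (resolution l x) = resolution l x" "resolution l (resolution m x) = resolution l x"
proof -
  define z where "z = resolution l x - resolution m (resolution l x)"
  have "resolution m z = 0"
    by (simp add: z_def resolution_diff resolution_idem)
  moreover have "rinner (B z) z \<le> l * (norm z)\<^sup>2"
    by (rule resolution_upper)
      (simp add: z_def resolution_diff resolution_idem resolution_commute_resolution[of l m])
  moreover have "l * (norm z)\<^sup>2 \<le> m * (norm z)\<^sup>2"
    using assms by (simp add: mult_right_mono)
  ultimately have "z = 0"
    using resolution_strict order_trans by blast
  then show "resolution m (resolution l x) = resolution l x"
    by (simp add: z_def)
  then show "resolution l (resolution m x) = resolution l x"
    by (simp add: resolution_commute_resolution[of l m])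
qed

text \<open>The distribution function of the spectral measure at \<open>x\<close>: the mass of the
  half-line up to \<open>l\<close>.\<close>

definition dist_fun :: "'a \<Rightarrow> real \<Rightarrow> real" where
  "dist_fun x l = rinner (resolution l x) x"

lemma dist_fun_eq_norm: "dist_fun x l = (norm (resolution l x))\<^sup>2"
  by (simp add: dist_fun_def rinner_projection[OF resolution_projection])

text \<open>Convergence of the vectors \<open>resolution l x\<close> along monotone \<open>l\<close>
  is reduced to convergence of real numbers.\<close>

lemma norm_resolution_diff:
  assumes "l \<le> m"
  shows "(norm (resolution m x - resolution l x))\<^sup>2 = dist_fun x m - dist_fun x l"
proof -
  have "rinner (resolution m x) (resolution l x) = dist_fun x l"
    using assms by (simp add: dist_fun_def resolution_sym resolution_mono rinner_commute)
  then show ?thesis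
    by (simp add: norm_diff_sq dist_fun_eq_norm)
qed

lemma dist_fun_mono: "l \<le> m \<Longrightarrow> dist_fun x l \<le> dist_fun x m"
  using norm_resolution_diff[of l m x] by (smt (verit) zero_le_power2)

text \<open>The vectors \<open>resolution (l n) x\<close> converge to some \<open>y\<close> because
  the numbers \<open>dist_fun x (l n)\<close> do. The possible jump
  \<open>z = y - resolution a y\<close> lies in the range of every \<open>resolution (l n)\<close>,
  so its form is at most \<open>a * (norm z)\<^sup>2\<close> in the limit; being annihilated by
  \<open>resolution a\<close>, it is 0.\<close>

lemma dist_fun_right_limit: "(\<lambda>n. dist_fun x (a + 1 / Suc n)) \<longlonglongrightarrow> dist_fun x a"
proof -
  define l where "l = (\<lambda>n::nat. a + 1 / Suc n)"
  have l_dec: "l n \<le> l m" if "m \<le> n" for m n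
    using that by (auto simp: l_def intro!: divide_left_mono)
  have l_ge: "a \<le> l n" for n
    by (simp add: l_def)
  have l_lim: "l \<longlonglongrightarrow> a"
    using tendsto_add[OF tendsto_const LIMSEQ_inverse_real_of_nat, of a]
    by (simp add: l_def inverse_eq_divide)
  have "decseq (\<lambda>n. dist_fun x (l n))"
    by (intro decseq_SucI dist_fun_mono l_dec) simp
  then have "convergent (\<lambda>n. dist_fun x (l n))"
    using decseq_convergent[of _ "dist_fun x a"] dist_fun_mono[OF l_ge] by (metis convergent_def)
  then have F_Cauchy: "Cauchy (\<lambda>n. dist_fun x (l n))"
    by (rule convergent_Cauchy)
  have dist_sq: "(dist (resolution (l m) x) (resolution (l n) x))\<^sup>2 = dist (dist_fun x (l m)) (dist_fun x (l n))" for m n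
  proof (induction m n rule: linorder_wlog)
    case (le m n)
    then show ?case
      using norm_resolution_diff[OF l_dec[OF le], of x] dist_fun_mono[OF l_dec[OF le], of x]
      by (simp add: dist_norm)
  next
    case (sym m n)
    then show ?case
      by (simp add: dist_commute)
  qed
  have "Cauchy (\<lambda>n. resolution (l n) x)"
  proof (rule metric_CauchyI)
    fix e :: real assume "e > 0"
    then obtain N where N: "\<And>m n. m \<ge> N \<Longrightarrow> n \<ge> N \<Longrightarrow> dist (dist_fun x (l m)) (dist_fun x (l n)) < e\<^sup>2"
      using metric_CauchyD[OF F_Cauchy, of "e\<^sup>2"] by auto
    have "dist (resolution (l m) x) (resolution (l n) x) < e" if "m \<ge> N" "n \<ge> N" for m n
    proof (rule power2_less_imp_less)
      show "(dist (resolution (l m) x) (resolution (l n) x))\<^sup>2 < e\<^sup>2"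
        using N[OF that] by (simp only: dist_sq)
    qed (use \<open>e > 0\<close> in simp)
    then show "\<exists>N. \<forall>m\<ge>N. \<forall>n\<ge>N. dist (resolution (l m) x) (resolution (l n) x) < e"
      by blast
  qed
  then obtain y where y: "(\<lambda>n. resolution (l n) x) \<longlonglongrightarrow> y"
    using Cauchy_convergent convergent_def by blast
  have lim: "(\<lambda>n. resolution m (resolution (l n) x)) \<longlonglongrightarrow> resolution m y" for m
    by (rule bounded_linear.tendsto[OF bounded_selfadjointD(1)[OF resolution_selfadjoint] y])
  have fix_y: "resolution (l k) y = y" for k
  proof (rule LIMSEQ_unique[OF lim])
    show "(\<lambda>n. resolution (l k) (resolution (l n) x)) \<longlonglongrightarrow> y"
      using y
    proof (rule Lim_transform_eventually)
      show "\<forall>\<^sub>F n in sequentially. resolution (l n) x = resolution (l k) (resolution (l n) x)"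
        using eventually_ge_at_top[of k] by eventually_elim (simp add: resolution_mono(1) l_dec)
    qed
  qed
  have a_y: "resolution a y = resolution a x"
    by (rule LIMSEQ_unique[OF lim]) (simp add: resolution_mono(2)[OF l_ge])
  define z where "z = y - resolution a y"
  have "resolution a z = 0"
    by (simp add: z_def resolution_diff resolution_idem)
  moreover have "rinner (B z) z \<le> a * (norm z)\<^sup>2"
  proof (rule LIMSEQ_le_const)
    show "(\<lambda>n. l n * (norm z)\<^sup>2) \<longlonglongrightarrow> a * (norm z)\<^sup>2"
      by (intro tendsto_mult_right l_lim)
    have "rinner (B z) z \<le> l n * (norm z)\<^sup>2" for n
      by (rule resolution_upper) (simp add: z_def resolution_diff fix_y resolution_mono(1)[OF l_ge])
    then show "\<exists>N. \<forall>n\<ge>N. rinner (B z) z \<le> l n * (norm z)\<^sup>2"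
      by blast
  qed
  ultimately have "z = 0"
    by (rule resolution_strict)
  then have "y = resolution a x"
    by (simp add: z_def a_y)
  then have "(\<lambda>n. rinner (resolution (l n) x) x) \<longlonglongrightarrow> rinner (resolution a x) x"
    using y by (intro rinner.tendsto tendsto_const) simp
  then show ?thesis
    by (simp add: dist_fun_def l_def)
qed

lemma dist_fun_right_continuous: "continuous (at_right a) (dist_fun x)"
proof (subst continuous_at_right_real_increasing)
  show "\<forall>e>0. \<exists>d>0. dist_fun x (a + d) - dist_fun x a < e"
  proof safe
    fix e :: real assume "e > 0"
    then have "\<forall>\<^sub>F n in sequentially. dist_fun x (a + 1 / Suc n) < dist_fun x a + e"
      by (intro order_tendstoD(2)[OF dist_fun_right_limit]) simp
    then obtain n where "dist_fun x (a + 1 / Suc n) < dist_fun x a + e"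
      by (meson eventually_sequentially order_refl)
    then show "\<exists>d>0. dist_fun x (a + d) - dist_fun x a < e"
      by (intro exI[of _ "1 / Suc n"]) auto
  qed
qed (rule dist_fun_mono)

definition bound :: real where
  "bound = (SOME K. 0 < K \<and> (\<forall>x. norm (B x) \<le> norm x * K))"

lemma bound: "0 < bound" "norm (B x) \<le> norm x * bound"
  using someI_ex[OF pos_bounded] unfolding bound_def by blast+

lemma rinner_B_bound: "\<bar>rinner (B x) x\<bar> \<le> bound * (norm x)\<^sup>2"
proof -
  have "\<bar>rinner (B x) x\<bar> \<le> norm (B x) * norm x"
    by (rule rinner_le_norm)
  also have "\<dots> \<le> (norm x * bound) * norm x"
    by (intro mult_right_mono bound) simp
  finally show ?thesis
    by (simp add: power2_eq_square mult_ac)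
qed

lemma resolution_below:
  assumes "l < - bound"
  shows "resolution l x = 0"
proof (rule ccontr)
  define y where "y = resolution l x"
  assume "resolution l x \<noteq> 0"
  then have "0 < (norm y)\<^sup>2"
    by (simp add: y_def)
  then have "l * (norm y)\<^sup>2 < - bound * (norm y)\<^sup>2"
    using assms by (intro mult_strict_right_mono)
  moreover have "rinner (B y) y \<le> l * (norm y)\<^sup>2"
    by (rule resolution_upper) (simp add: y_def resolution_idem)
  ultimately show False
    using rinner_B_bound[of y] by linarith
qed

lemma resolution_above:
  assumes "bound \<le> l"
  shows "resolution l x = x"
proof -
  define z where "z = x - resolution l x"
  have "rinner (B z) z \<le> bound * (norm z)\<^sup>2"
    using rinner_B_bound[of z] by linarith
  also have "\<dots> \<le> l * (norm z)\<^sup>2"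
    using assms by (simp add: mult_right_mono)
  finally have "rinner (B z) z \<le> l * (norm z)\<^sup>2" .
  moreover have "resolution l z = 0"
    by (simp add: z_def resolution_diff resolution_idem)
  ultimately have "z = 0"
    by (rule resolution_strict[rotated])
  then show ?thesis
    by (simp add: z_def)
qed

section \<open>From distribution functions to projections for Borel sets\<close>

definition mu :: "'a \<Rightarrow> real measure" where
  "mu x = interval_measure (dist_fun x)"

lemma sets_mu [simp, measurable_cong]: "sets (mu x) = sets borel"
  and space_mu [simp]: "space (mu x) = UNIV"
  by (simp_all add: mu_def)

lemma emeasure_mu_Ioc: "a \<le> b \<Longrightarrow> emeasure (mu x) {a<..b} = ennreal (dist_fun x b - dist_fun x a)"
  unfolding mu_def by (intro emeasure_interval_measure_Ioc dist_fun_mono dist_fun_right_continuous)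

lemma emeasure_mu_Ioc_eq_total:
  assumes "a < - bound" "bound \<le> b"
  shows "emeasure (mu x) {a<..b} = ennreal ((norm x)\<^sup>2)"
proof -
  have "a \<le> b"
    using assms bound(1) by linarith
  from emeasure_mu_Ioc[OF this, of x] assms show ?thesis
    by (simp add: dist_fun_eq_norm resolution_below resolution_above)
qed

lemma emeasure_mu_UNIV: "emeasure (mu x) UNIV = ennreal ((norm x)\<^sup>2)"
proof -
  have "(\<lambda>n. emeasure (mu x) {- real n<..real n}) \<longlonglongrightarrow> emeasure (mu x) (\<Union>n. {- real n<..real n})"
    by (rule Lim_emeasure_incseq) (auto simp: incseq_def)
  moreover have "(\<Union>n. {- real n<..real n}) = UNIV"
  proof (intro set_eqI iffI UNIV_I)
    fix t :: real
    obtain n where "\<bar>t\<bar> < real n"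
      using reals_Archimedean2 by blast
    then show "t \<in> (\<Union>n. {- real n<..real n})"
      by (intro UN_I[of n]) auto
  qed
  moreover have "(\<lambda>n. emeasure (mu x) {- real n<..real n}) \<longlonglongrightarrow> ennreal ((norm x)\<^sup>2)"
  proof (rule tendsto_eventually)
    obtain N where "bound < real N"
      using reals_Archimedean2 by blast
    then show "\<forall>\<^sub>F n in sequentially. emeasure (mu x) {- real n<..real n} = ennreal ((norm x)\<^sup>2)"
      by (intro eventually_sequentiallyI[of N] emeasure_mu_Ioc_eq_total) linarith+
  qed
  ultimately show ?thesis
    using LIMSEQ_unique by metis
qed

lemma finite_measure_mu: "finite_measure (mu x)"
  by (rule finite_measureI) (simp add: emeasure_mu_UNIV)

lemma measure_mu_UNIV: "measure (mu x) UNIV = (norm x)\<^sup>2"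
  by (simp add: measure_def emeasure_mu_UNIV)

lemma measure_mu_le: "measure (mu x) S \<le> (norm x)\<^sup>2"
  using finite_measure.bounded_measure[OF finite_measure_mu, of x S] by (simp add: measure_mu_UNIV)

lemma measure_mu_Ioc: "a \<le> b \<Longrightarrow> measure (mu x) {a<..b} = dist_fun x b - dist_fun x a"
  by (simp add: measure_def emeasure_mu_Ioc dist_fun_mono)

text \<open>A single projection has to produce the mass of \<open>S\<close> for all vectors
  \<open>x\<close> at once. Its form determines it, so identities between spectral projections
  reduce to identities between measures.\<close>

definition represents :: "real set \<Rightarrow> ('a \<Rightarrow> 'a) \<Rightarrow> bool" where
  "represents S P \<longleftrightarrow> orthogonal_projection P \<and> (\<forall>x. rinner (P x) x = measure (mu x) S)"

lemma represents_unique: "represents S P \<Longrightarrow> represents S Q \<Longrightarrow> P = Q"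
  unfolding represents_def by (intro selfadjoint_eqI orthogonal_projectionD(1)) auto

text \<open>Masses of two disjoint sets add up to at most \<open>(norm x)\<^sup>2\<close>, so the
  projections are mutually orthogonal and their strong sum is again a projection.\<close>

lemma represents_sums:
  assumes F: "range F \<subseteq> sets borel" "disjoint_family F" and P: "\<And>n. represents (F n) (P n)"
  obtains Q where "represents (\<Union>n. F n) Q" and "\<And>x. (\<lambda>n. P n x) sums Q x"
proof -
  have proj: "orthogonal_projection (P n)" and meas: "rinner (P n x) x = measure (mu x) (F n)" for n x
    using P by (auto simp: represents_def)
  have F': "F n \<in> sets (mu x)" for n x
    using F by auto
  have "P m (P n x) = 0" if "m \<noteq> n" for m n x
  proof (rule projections_orthogonal[OF proj proj])
    fix x
    have "measure (mu x) (F m) + measure (mu x) (F n) = measure (mu x) (F m \<union> F n)"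
      using disjoint_family_onD[OF F(2), of m n] that
      by (intro finite_measure.finite_measure_Union[symmetric] finite_measure_mu F') auto
    also have "\<dots> \<le> (norm x)\<^sup>2"
      by (rule measure_mu_le)
    finally show "rinner (P m x) x + rinner (P n x) x \<le> (norm x)\<^sup>2"
      by (simp add: meas)
  qed
  then obtain Q where Q: "orthogonal_projection Q" and sums: "\<And>x. (\<lambda>n. P n x) sums Q x"
    using orthogonal_projections_sums[of P, OF proj] by metis
  have "rinner (Q x) x = measure (mu x) (\<Union>n. F n)" for x
  proof (rule sums_unique2)
    show "(\<lambda>n. measure (mu x) (F n)) sums rinner (Q x) x"
      using bounded_linear.sums[OF rinner.bounded_linear_left sums[of x], of x] by (simp add: meas)
    show "(\<lambda>n. measure (mu x) (F n)) sums measure (mu x) (\<Union>n. F n)"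
      using F by (intro finite_measure.finite_measure_UNION finite_measure_mu) auto
  qed
  with Q have "represents (\<Union>n. F n) Q"
    by (simp add: represents_def)
  with sums that show thesis
    by blast
qed

lemma represents_Ioc:
  assumes "a \<le> b"
  shows "represents {a<..b} (\<lambda>x. resolution b x - resolution a x)"
proof -
  have "orthogonal_projection (\<lambda>x. resolution b x - resolution a x)"
    unfolding orthogonal_projection_def
    by (intro conjI bounded_selfadjoint_diff resolution_selfadjoint)
      (simp add: fun_eq_iff resolution_diff resolution_idem resolution_mono[OF assms])
  then show ?thesis
    by (simp add: represents_def measure_mu_Ioc[OF assms] rinner.diff_left dist_fun_def)
qed

lemma represents_empty: "represents {} (\<lambda>x. 0)"
  using represents_Ioc[of 0 0] by simp

lemma represents_compl:
  assumes "represents S P" "S \<in> sets borel"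
  shows "represents (UNIV - S) (\<lambda>x. x - P x)"
  using assms finite_measure.finite_measure_compl[OF finite_measure_mu, of S]
  by (auto simp: represents_def orthogonal_projection_compl rinner.diff_left rinner_self measure_mu_UNIV)

text \<open>Dynkin's theorem for the intersection-stable generator of half-open intervals:
  representable sets contain it and are closed under complements and countable disjoint
  unions.\<close>

lemma represents_exists:
  assumes "S \<in> sets borel"
  shows "\<exists>P. represents S P"
proof -
  define G where "G = range (\<lambda>(a, b). {a<..b::real})"
  have borel: "sets borel = sigma_sets UNIV G"
    by (subst borel_sigma_sets_Ioc) (simp add: G_def)
  have "{a<..b} \<inter> {c<..d} = {max a c<..min b d}" for a b c d :: real
    by auto
  then have "Int_stable G"
    unfolding Int_stable_def G_def by auto
  moreover have "G \<subseteq> Pow UNIV"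
    by simp
  ultimately show ?thesis
    using assms unfolding borel
  proof (induction rule: sigma_sets_induct_disjoint)
    case (basic A)
    then obtain a b where "A = {a<..b}"
      by (auto simp: G_def)
    then show ?case
      using represents_Ioc[of a b] represents_empty by (cases "a \<le> b") auto
  next
    case empty
    then show ?case
      using represents_empty by blast
  next
    case (compl A)
    then show ?case
      using represents_compl borel by blast
  next
    case (union F)
    then obtain P where "\<And>n. represents (F n) (P n)"
      by metis
    then show ?case
      using represents_sums[of F P] union borel by metis
  qed
qed

definition spectral_family :: "real set \<Rightarrow> 'a \<Rightarrow> 'a" where
  "spectral_family S = (SOME P. represents S P)"

lemma represents_spectral_family: "S \<in> sets borel \<Longrightarrow> represents S (spectral_family S)"
  unfolding spectral_family_def using someI_ex[OF represents_exists] .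

lemma projection_valued_measure_spectral_family: "projection_valued_measure spectral_family"
  unfolding projection_valued_measure_def
proof (intro conjI ballI allI impI)
  show "orthogonal_projection (spectral_family S)" if "S \<in> sets borel" for S
    using represents_spectral_family[OF that] by (simp add: represents_def)
  show "spectral_family {} = (\<lambda>x. 0)"
    using represents_unique[OF represents_spectral_family represents_empty] by simp
  show "spectral_family UNIV = id"
    using represents_unique[OF represents_spectral_family represents_compl[OF represents_empty]]
    by (simp add: id_def)
  fix F :: "nat \<Rightarrow> real set" and x
  assume F: "range F \<subseteq> sets borel" "disjoint_family F"
  then have rep: "represents (F n) (spectral_family (F n))" for n
    by (intro represents_spectral_family) auto
  have Un: "(\<Union>n. F n) \<in> sets borel"
    using F by auto
  obtain Q where "represents (\<Union>n. F n) Q" "\<And>x. (\<lambda>n. spectral_family (F n) x) sums Q x"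
    using represents_sums[OF F rep] by metis
  then show "(\<lambda>n. spectral_family (F n) x) sums spectral_family (\<Union>n. F n) x"
    using represents_unique[OF represents_spectral_family[OF Un]] by metis
qed

lemma scalar_measure_spectral_family: "scalar_measure spectral_family x = mu x"
proof (rule measure_eqI)
  fix S assume "S \<in> sets (scalar_measure spectral_family x)"
  then have S: "S \<in> sets borel"
    by simp
  then show "emeasure (scalar_measure spectral_family x) S = emeasure (mu x) S"
    using represents_spectral_family[OF S] emeasure_scalar_measure[OF projection_valued_measure_spectral_family S]
      finite_measure.emeasure_eq_measure[OF finite_measure_mu]
    by (simp add: represents_def)
qed simp

section \<open>The integral representation of the operator\<close>

lemma AE_mu_bounded: "AE t in mu x. - bound - 1 < t \<and> t \<le> bound"
proof -
  have "measure (mu x) (UNIV - {- bound - 1<..bound}) = 0"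
    using emeasure_mu_Ioc_eq_total[of "- bound - 1" bound x]
      finite_measure.finite_measure_compl[OF finite_measure_mu, of "{- bound - 1<..bound}" x]
    by (simp add: measure_mu_UNIV) (simp add: measure_def)
  then have "emeasure (mu x) (UNIV - {- bound - 1<..bound}) = 0"
    by (simp add: finite_measure.emeasure_eq_measure[OF finite_measure_mu])
  then show ?thesis
    by (intro AE_I[where N = "UNIV - {- bound - 1<..bound}"]) auto
qed

lemma integrable_mu:
  assumes "S \<in> sets borel"
  shows "integrable (mu x) (\<lambda>t. indicator S t * t)"
proof (rule finite_measure.integrable_const_bound[OF finite_measure_mu])
  show "AE t in mu x. norm (indicator S t * t) \<le> bound + 1"
    using AE_mu_bounded[of x] by eventually_elim (use bound(1) in \<open>auto simp: indicator_def\<close>)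
qed (use assms in measurable)

lemma integral_mu_Ioc_bounds:
  assumes "a \<le> b"
  shows "a * (dist_fun x b - dist_fun x a) \<le> (\<integral>t. indicator {a<..b} t * t \<partial>mu x)"
    and "(\<integral>t. indicator {a<..b} t * t \<partial>mu x) \<le> b * (dist_fun x b - dist_fun x a)"
proof -
  have int: "integrable (mu x) (\<lambda>t. c * indicator {a<..b} t)" for c :: real
    by (intro integrable_mult_right integrable_real_indicator)
      (simp_all add: finite_measure.emeasure_finite[OF finite_measure_mu] top.not_eq_extremum[symmetric])
  have eq: "(\<integral>t. c * indicator {a<..b} t \<partial>mu x) = c * (dist_fun x b - dist_fun x a)" for c :: real
    by (simp add: measure_mu_Ioc[OF assms])
  show "a * (dist_fun x b - dist_fun x a) \<le> (\<integral>t. indicator {a<..b} t * t \<partial>mu x)"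
    unfolding eq[symmetric] by (intro integral_mono int integrable_mu) (auto simp: indicator_def)
  show "(\<integral>t. indicator {a<..b} t * t \<partial>mu x) \<le> b * (dist_fun x b - dist_fun x a)"
    unfolding eq[symmetric] by (intro integral_mono int integrable_mu) (auto simp: indicator_def)
qed

text \<open>On \<open>(a, b]\<close> the form of \<open>B\<close> and the integral both lie between \<open>a\<close> and \<open>b\<close> times the mass,
  which makes their difference constant as a function of the end point.\<close>

lemma integral_mu: "(\<integral>t. t \<partial>mu x) = rinner (B x) x"
proof -
  define p where "p s = rinner (B (resolution s x)) x - (\<integral>t. indicator {..s} t * t \<partial>mu x)" for s
  \<comment> \<open>Strictly below \<open>- bound\<close>, since the resolution may already be
    nonzero at \<open>- bound\<close> itself.\<close>
  define lo where "lo = - bound - 1"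
  have "p bound = p lo"
  proof (rule eq_if_variation_dominated[where p = p and F = "dist_fun x"])
    show "lo \<le> bound"
      using bound(1) by (simp add: lo_def)
    fix a b :: real assume "a \<le> b"
    define y where "y = resolution b x - resolution a x"
    have y: "resolution b y = y" "resolution a y = 0"
      by (simp_all add: y_def resolution_diff resolution_idem resolution_mono[OF \<open>a \<le> b\<close>])
    have "(\<integral>t. indicator {..b} t * t \<partial>mu x) - (\<integral>t. indicator {..a} t * t \<partial>mu x)
        = (\<integral>t. indicator {..b} t * t - indicator {..a} t * t \<partial>mu x)"
      by (intro Bochner_Integration.integral_diff[symmetric] integrable_mu) auto
    also have "\<dots> = (\<integral>t. indicator {a<..b} t * t \<partial>mu x)"
      using \<open>a \<le> b\<close> by (intro Bochner_Integration.integral_cong) (auto simp: indicator_def)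
    finally have int: "(\<integral>t. indicator {..b} t * t \<partial>mu x) - (\<integral>t. indicator {..a} t * t \<partial>mu x)
        = (\<integral>t. indicator {a<..b} t * t \<partial>mu x)" .
    \<comment> \<open>\<open>B\<close> commutes with the resolution, so \<open>B y\<close> lies in
      the range of \<open>resolution b - resolution a\<close> together with \<open>y\<close>; only
      the component \<open>y\<close> of \<open>x\<close> contributes.\<close>
    have "rinner (B y) x = rinner (B y) y"
    proof -
      have "B y = resolution b (B y) - resolution a (B y)"
        by (simp add: resolution_commute_B y zero)
      then have "rinner (B y) x = rinner (resolution b (B y) - resolution a (B y)) x"
        by simp
      also have "\<dots> = rinner (B y) y"
        by (simp add: rinner_simps resolution_sym y_def)
      finally show ?thesis .
    qed
    then have form: "rinner (B (resolution b x)) x - rinner (B (resolution a x)) x = rinner (B y) y"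
      by (simp add: y_def diff rinner.diff_left)
    have norm_y: "(norm y)\<^sup>2 = dist_fun x b - dist_fun x a"
      unfolding y_def by (rule norm_resolution_diff[OF \<open>a \<le> b\<close>])
    have "rinner (B y) y \<le> b * (dist_fun x b - dist_fun x a)"
      and "a * (dist_fun x b - dist_fun x a) \<le> rinner (B y) y"
      using resolution_upper[OF y(1)] resolution_lower[OF y(2)] by (simp_all add: norm_y)
    then show "\<bar>p b - p a\<bar> \<le> (b - a) * (dist_fun x b - dist_fun x a)"
      using integral_mu_Ioc_bounds[OF \<open>a \<le> b\<close>, of x] form int
      unfolding p_def left_diff_distrib by linarith
  qed
  moreover have "p lo = 0"
  proof -
    have "(\<integral>t. indicator {..lo} t * t \<partial>mu x) = (\<integral>t. 0 \<partial>mu x)"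
      using AE_mu_bounded[of x] by (intro integral_cong_AE) (auto simp: lo_def)
    then show ?thesis
      by (simp add: p_def lo_def resolution_below zero rinner.zero_left)
  qed
  moreover have "(\<integral>t. indicator {..bound} t * t \<partial>mu x) = (\<integral>t. t \<partial>mu x)"
    using AE_mu_bounded[of x] by (intro integral_cong_AE) auto
  ultimately show ?thesis
    by (simp add: p_def resolution_above)
qed

theorem spectral_measure_exists: "\<exists>E. is_spectral_measure B E"
proof (intro exI)
  have "spectral_family {- bound - 1..bound + 1} = id"
  proof (rule represents_unique)
    have "represents UNIV (id :: 'a \<Rightarrow> 'a)"
      using represents_compl[OF represents_empty] by (simp add: id_def)
    moreover have "measure (mu x) {- bound - 1..bound + 1} = measure (mu x) UNIV" for x
      using AE_mu_bounded[of x] by (intro measure_eq_AE) auto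
    ultimately show "represents {- bound - 1..bound + 1} id"
      by (simp add: represents_def)
  qed (simp add: represents_spectral_family)
  moreover have "cinner (B x) x = complex_of_real (rinner (B x) x)" for x
    using selfadjoint cinner_commute[of "B x" x]
    by (simp add: bounded_selfadjoint_def rinner_def complex_eq_iff)
  ultimately show "is_spectral_measure B spectral_family"
    unfolding is_spectral_measure_def
    by (auto simp: projection_valued_measure_spectral_family scalar_measure_spectral_family integral_mu
        intro!: exI[of _ "bound + 1"])
qed

end

lemma is_spectral_measure_spectral_measure:
  "bounded_selfadjoint B \<Longrightarrow> is_spectral_measure B (spectral_measure B)"
  unfolding spectral_measure_def
  using someI_ex[OF selfadjoint_operator.spectral_measure_exists[OF selfadjoint_operator.intro]] .

section \<open>Spectral subspaces\<close>

text \<open>Used with operators bounded below: to show that an image is closed, and to pass a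
  convergent subsequence from \<open>A i\<close> to \<open>Q i\<close>.\<close>

lemma Cauchy_if_dominated:
  fixes f g :: "nat \<Rightarrow> 'a::real_normed_vector"
  assumes "e > 0" and le: "\<And>m n. e * norm (f m - f n) \<le> norm (g m - g n)" and g: "Cauchy g"
  shows "Cauchy f"
proof (rule metric_CauchyI)
  fix d :: real assume "d > 0"
  then obtain N where N: "\<And>m n. m \<ge> N \<Longrightarrow> n \<ge> N \<Longrightarrow> dist (g m) (g n) < e * d"
    using metric_CauchyD[OF g, of "e * d"] \<open>e > 0\<close> by auto
  have "dist (f m) (f n) < d" if "m \<ge> N" "n \<ge> N" for m n
  proof -
    have "e * dist (f m) (f n) < e * d"
      using le[of m n] N[OF that] by (simp add: dist_norm)
    then show ?thesis
      using \<open>e > 0\<close> by simp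
  qed
  then show "\<exists>N. \<forall>m\<ge>N. \<forall>n\<ge>N. dist (f m) (f n) < d"
    by blast
qed

locale operator_with_spectral_measure =
  fixes B :: "'a::complex_hilbert \<Rightarrow> 'a" and E :: "real set \<Rightarrow> 'a \<Rightarrow> 'a"
  assumes selfadjoint: "bounded_selfadjoint B" and spectral: "is_spectral_measure B E"
begin

sublocale bounded_linear B
  using selfadjoint by (rule bounded_selfadjointD)

lemma pvm: "projection_valued_measure E"
  using spectral by (simp add: is_spectral_measure_def)

lemma proj: "S \<in> sets borel \<Longrightarrow> orthogonal_projection (E S)"
  using pvm by (simp add: projection_valued_measure_def)

lemma E_empty: "E {} x = 0"
  using pvm by (simp add: projection_valued_measure_def)

lemma E_UNIV: "E UNIV x = x"
  using pvm by (simp add: projection_valued_measure_def)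

lemma E_linear: "S \<in> sets borel \<Longrightarrow> bounded_linear (E S)"
  using bounded_selfadjointD(1) orthogonal_projectionD(1) proj by blast

lemma E_add: "S \<in> sets borel \<Longrightarrow> E S (x + y) = E S x + E S y"
  using linear_add[OF bounded_linear.linear[OF E_linear]] .

lemma E_diff: "S \<in> sets borel \<Longrightarrow> E S (x - y) = E S x - E S y"
  using linear_diff[OF bounded_linear.linear[OF E_linear]] .

lemma E_sym: "S \<in> sets borel \<Longrightarrow> rinner (E S x) y = rinner x (E S y)"
  using bounded_selfadjointD(3)[OF orthogonal_projectionD(1)[OF proj]] .

lemma E_idem: "S \<in> sets borel \<Longrightarrow> E S (E S x) = E S x"
  using orthogonal_projectionD(2)[OF proj] .

lemma E_Un:
  assumes "S \<in> sets borel" "T \<in> sets borel" "S \<inter> T = {}"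
  shows "E (S \<union> T) x = E S x + E T x"
proof -
  have "range (binaryset S T) \<subseteq> sets borel" "disjoint_family (binaryset S T)"
    using assms by (auto simp: binaryset_def disjoint_family_on_def)
  then have "(\<lambda>n. E (binaryset S T n) x) sums E (\<Union>n. binaryset S T n) x"
    using pvm unfolding projection_valued_measure_def by blast
  moreover have "(\<lambda>n. E (binaryset S T n) x) sums (\<Sum>n\<in>{0, 1}. E (binaryset S T n) x)"
    by (rule sums_finite) (auto simp: binaryset_def E_empty)
  ultimately have "E (\<Union>n. binaryset S T n) x = (\<Sum>n\<in>{0, 1}. E (binaryset S T n) x)"
    by (rule sums_unique2)
  then show ?thesis
    by (simp add: UN_binaryset_eq) (simp add: binaryset_def)
qed

text \<open>By additivity the two forms sum to that of the projection
  \<open>E (S \<union> T)\<close>, which is at most the identity.\<close>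

lemma E_disjoint:
  assumes "S \<in> sets borel" "T \<in> sets borel" "S \<inter> T = {}"
  shows "E S (E T x) = 0"
proof (rule projections_orthogonal[OF proj proj])
  fix x
  have "rinner (E S x) x + rinner (E T x) x = rinner (E (S \<union> T) x) x"
    using assms by (simp add: E_Un rinner_add_left)
  also have "\<dots> = (norm (E (S \<union> T) x))\<^sup>2"
    using assms by (intro rinner_projection proj) auto
  also have "\<dots> \<le> (norm x)\<^sup>2"
    using assms by (intro power_mono norm_projection_le proj) auto
  finally show "rinner (E S x) x + rinner (E T x) x \<le> (norm x)\<^sup>2" .
qed (use assms in auto)

text \<open>Multiplicativity from additivity: split \<open>T\<close> along \<open>S\<close>, then
  \<open>S\<close> along \<open>T\<close>; projections of disjoint sets annihilate each
  other.\<close>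

lemma E_Int:
  assumes S: "S \<in> sets borel" and T: "T \<in> sets borel"
  shows "E S (E T x) = E (S \<inter> T) x"
proof -
  have "E T x = E (S \<inter> T) x + E (T - S) x"
    using assms by (subst E_Un[symmetric]) (auto intro: arg_cong[where f = "\<lambda>S. E S x"])
  moreover have "E S (E (T - S) x) = 0"
    using assms by (intro E_disjoint) auto
  moreover have "E S (E (S \<inter> T) x) = E (S \<inter> T) (E (S \<inter> T) x) + E (S - T) (E (S \<inter> T) x)"
    using assms by (subst E_Un[symmetric]) (auto intro: arg_cong[where f = "\<lambda>S. E S y" for y])
  moreover have "E (S - T) (E (S \<inter> T) x) = 0"
    using assms by (intro E_disjoint) auto
  ultimately show ?thesis
    using assms by (simp add: E_add E_idem)
qed

lemma E_compl: "S \<in> sets borel \<Longrightarrow> E (- S) x = x - E S x"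
  using E_Un[of S "- S" x] by (simp add: E_UNIV borel_comp algebra_simps)

section \<open>Scalar measures and the quadratic form on spectral subspaces\<close>

lemma emeasure_scalar:
  "S \<in> sets borel \<Longrightarrow> emeasure (scalar_measure E x) S = ennreal ((norm (E S x))\<^sup>2)"
  by (simp add: emeasure_scalar_measure[OF pvm] rinner_projection[OF proj])

lemma measure_scalar:
  "S \<in> sets borel \<Longrightarrow> measure (scalar_measure E x) S = (norm (E S x))\<^sup>2"
  by (simp add: measure_def emeasure_scalar)

lemma finite_scalar: "finite_measure (scalar_measure E x)"
  by (rule finite_measureI) (simp add: emeasure_scalar)

lemma AE_scalar_bounded: "\<exists>r. \<forall>x. AE t in scalar_measure E x. \<bar>t\<bar> \<le> r"
proof -
  obtain r where r: "E {- r..r} = id"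
    using spectral by (auto simp: is_spectral_measure_def)
  have "AE t in scalar_measure E x. \<bar>t\<bar> \<le> r" for x
  proof (rule AE_I[where N = "- {- r..r}"])
    show "emeasure (scalar_measure E x) (- {- r..r}) = 0"
      by (simp add: emeasure_scalar E_compl r)
  qed auto
  then show ?thesis
    by blast
qed

lemma integrable_scalar:
  assumes "S \<in> sets borel"
  shows "integrable (scalar_measure E x) (\<lambda>t. indicator S t * t)"
proof -
  obtain r where r: "AE t in scalar_measure E x. \<bar>t\<bar> \<le> r"
    using AE_scalar_bounded by blast
  show ?thesis
  proof (rule finite_measure.integrable_const_bound[OF finite_scalar])
    show "AE t in scalar_measure E x. norm (indicator S t * t) \<le> \<bar>r\<bar>"
      using r by eventually_elim (auto simp: indicator_def)
  qed (use assms in measurable)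
qed

lemma rinner_B_integral: "rinner (B x) x = (\<integral>t. t \<partial>scalar_measure E x)"
  using spectral by (simp add: is_spectral_measure_def rinner_def)

text \<open>Multiplicativity gives \<open>E T (E S x) = E (S \<inter> T) x\<close>. Passing to a
  spectral subspace thus restricts the measure, and the form of \<open>B\<close> there becomes an
  integral over \<open>S\<close>.\<close>

lemma scalar_measure_E:
  assumes S: "S \<in> sets borel"
  shows "scalar_measure E (E S x) = density (scalar_measure E x) (\<lambda>t. ennreal (indicator S t))"
proof (rule measure_eqI)
  fix T assume "T \<in> sets (scalar_measure E (E S x))"
  then have T: "T \<in> sets borel"
    by simp
  have "emeasure (density (scalar_measure E x) (\<lambda>t. ennreal (indicator S t))) T
      = (\<integral>\<^sup>+ t. ennreal (indicator S t) * indicator T t \<partial>scalar_measure E x)"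
    using S T by (intro emeasure_density) auto
  also have "\<dots> = (\<integral>\<^sup>+ t. indicator (S \<inter> T) t \<partial>scalar_measure E x)"
    by (intro nn_integral_cong) (auto simp: indicator_def)
  also have "\<dots> = emeasure (scalar_measure E x) (S \<inter> T)"
    using S T by (intro nn_integral_indicator) auto
  finally show "emeasure (scalar_measure E (E S x)) T
      = emeasure (density (scalar_measure E x) (\<lambda>t. ennreal (indicator S t))) T"
    using S T by (simp add: emeasure_scalar E_Int Int_commute)
qed simp

lemma rinner_B_E:
  assumes S: "S \<in> sets borel"
  shows "rinner (B (E S x)) (E S x) = (\<integral>t. indicator S t * t \<partial>scalar_measure E x)"
  unfolding rinner_B_integral scalar_measure_E[OF S] using S by (subst integral_density) auto

lemma rinner_B_E_lower:
  assumes S: "S \<in> sets borel" and le: "\<And>t. t \<in> S \<Longrightarrow> a \<le> t"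
  shows "a * (norm (E S x))\<^sup>2 \<le> rinner (B (E S x)) (E S x)"
proof -
  have "a * (norm (E S x))\<^sup>2 = (\<integral>t. a * indicator S t \<partial>scalar_measure E x)"
    using S by (simp add: measure_scalar)
  also have "\<dots> \<le> (\<integral>t. indicator S t * t \<partial>scalar_measure E x)"
    using S le
    by (intro integral_mono integrable_scalar integrable_mult_right integrable_real_indicator)
      (auto simp: indicator_def emeasure_scalar)
  finally show ?thesis
    by (simp add: rinner_B_E[OF S])
qed

lemma rinner_B_E_upper:
  assumes S: "S \<in> sets borel" and le: "\<And>t. t \<in> S \<Longrightarrow> t \<le> b"
  shows "rinner (B (E S x)) (E S x) \<le> b * (norm (E S x))\<^sup>2"
proof -
  have "(\<integral>t. indicator S t * t \<partial>scalar_measure E x) \<le> (\<integral>t. b * indicator S t \<partial>scalar_measure E x)"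
    using S le
    by (intro integral_mono integrable_scalar integrable_mult_right integrable_real_indicator)
      (auto simp: indicator_def emeasure_scalar)
  also have "\<dots> = b * (norm (E S x))\<^sup>2"
    using S by (simp add: measure_scalar)
  finally show ?thesis
    by (simp add: rinner_B_E[OF S])
qed

lemma B_sym: "rinner (B x) y = rinner x (B y)"
  using bounded_selfadjointD(3)[OF selfadjoint] .

text \<open>Splitting the integral over \<open>S\<close> and its complement gives
  \<open>rinner (B x) x = rinner (B u) u + rinner (B v) v\<close>. Since \<open>x = u + v\<close>,
  the cross term \<open>2 * rinner (B u) v\<close> must vanish.\<close>

lemma rinner_B_E_compl:
  assumes S: "S \<in> sets borel"
  shows "rinner (B (E S x)) (x - E S x) = 0"
proof -
  define u v where "u = E S x" and "v = E (- S) x"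
  have v: "v = x - u"
    using S by (simp add: u_def v_def E_compl)
  have "(\<integral>t. t \<partial>scalar_measure E x)
      = (\<integral>t. indicator S t * t + indicator (- S) t * t \<partial>scalar_measure E x)"
    by (intro Bochner_Integration.integral_cong) (auto simp: indicator_def)
  also have "\<dots> = (\<integral>t. indicator S t * t \<partial>scalar_measure E x) + (\<integral>t. indicator (- S) t * t \<partial>scalar_measure E x)"
    using S by (intro Bochner_Integration.integral_add integrable_scalar) auto
  finally have "rinner (B x) x = rinner (B u) u + rinner (B v) v"
    using S by (simp add: rinner_B_integral[of x] rinner_B_E u_def v_def)
  moreover have "rinner (B x) x = rinner (B (u + v)) (u + v)"
    by (simp add: v)
  ultimately have "rinner (B u) v = 0"
    using B_sym[of v u] by (simp add: add rinner_add_left rinner_add_right rinner_commute)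
  then show ?thesis
    by (simp add: v u_def)
qed

lemma E_commute:
  assumes S: "S \<in> sets borel"
  shows "B (E S x) = E S (B x)"
proof (rule invariant_range_commute[OF proj[OF S] selfadjoint])
  fix x assume x: "E S x = x"
  \<comment> \<open>The component of \<open>B x\<close> leaving the range. The vanishing cross term,
    applied to \<open>x + y\<close>, makes \<open>y\<close> orthogonal to \<open>B x\<close>, hence
    zero.\<close>
  define y where "y = B x - E S (B x)"
  have "E S y = 0"
    using S by (simp add: y_def E_diff E_idem)
  then have "rinner (B x) y = 0"
    using rinner_B_E_compl[OF S, of "x + y"] x S by (simp add: E_add)
  moreover have "rinner y (B x) = (norm y)\<^sup>2"
    using rinner_projection[OF orthogonal_projection_compl[OF proj[OF S]], of "B x"] by (simp add: y_def)
  ultimately show "E S (B x) = B x"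
    by (simp add: rinner_commute y_def)
qed

text \<open>Polarization turns the bound on the quadratic form into a bound on the norm.\<close>

lemma norm_B_upper:
  assumes x: "E {- e..e} x = x"
  shows "norm (B x) \<le> e * norm x"
proof (cases "x = 0 \<or> B x = 0")
  case True
  show ?thesis
  proof (cases "x = 0")
    case False
    \<comment> \<open>For negative \<open>e\<close> the interval is empty and \<open>x\<close> would
      be 0.\<close>
    then have "e \<ge> 0"
      using x E_empty[of x] by (cases "e \<ge> 0") auto
    with True False show ?thesis
      by simp
  qed (simp add: zero)
next
  case False
  \<comment> \<open>The direction of \<open>B x\<close>, scaled to the norm of \<open>x\<close>, so
    that \<open>rinner (B x) y = norm x * norm (B x)\<close>.\<close>
  define y where "y = (norm x / norm (B x)) *\<^sub>R B x"
  have y: "E {- e..e} y = y"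
    using linear_scale[OF bounded_linear.linear[OF E_linear], of "{- e..e}"]
    by (simp add: y_def x flip: E_commute)
  have form: "\<bar>rinner (B z) z\<bar> \<le> e * (norm z)\<^sup>2" if "E {- e..e} z = z" for z
  proof -
    have "rinner (B (E {- e..e} z)) (E {- e..e} z) \<le> e * (norm (E {- e..e} z))\<^sup>2"
      by (rule rinner_B_E_upper) auto
    moreover have "- e * (norm (E {- e..e} z))\<^sup>2 \<le> rinner (B (E {- e..e} z)) (E {- e..e} z)"
      by (rule rinner_B_E_lower) auto
    ultimately show ?thesis
      unfolding that by linarith
  qed
  have sym: "rinner (B y) x = rinner (B x) y"
    by (metis B_sym rinner_commute)
  have "4 * rinner (B x) y = rinner (B (x + y)) (x + y) - rinner (B (x - y)) (x - y)"
    by (simp add: add diff rinner_simps sym)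
  also have "\<dots> \<le> e * (norm (x + y))\<^sup>2 + e * (norm (x - y))\<^sup>2"
    using form[of "x + y"] form[of "x - y"] x y by (simp add: E_add E_diff)
  also have "\<dots> = 2 * e * ((norm x)\<^sup>2 + (norm y)\<^sup>2)"
    by (simp add: norm_add_sq norm_diff_sq algebra_simps)
  also have "norm y = norm x"
    using False by (simp add: y_def)
  finally have "4 * (norm x * norm (B x)) \<le> 4 * (e * (norm x * norm x))"
    using False by (simp add: y_def rinner_scaleR_right rinner_self power2_eq_square)
  then have "norm x * norm (B x) \<le> norm x * (e * norm x)"
    by (simp add: mult_ac)
  then show ?thesis
    using False by simp
qed

text \<open>Split \<open>x\<close> into \<open>p\<close> over the part above \<open>e\<close> and
  \<open>m\<close> over the part below \<open>- e\<close>. Testing \<open>B x\<close> against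
  \<open>p - m\<close>, which has the norm of \<open>x\<close>, lets the positive and the negative
  part both contribute with the right sign.\<close>

lemma norm_B_lower:
  assumes "e \<ge> 0" and x: "E {- e..e} x = 0"
  shows "e * norm x \<le> norm (B x)"
proof (cases "x = 0")
  case False
  define p m where "p = E {e<..} x" and "m = E {..<- e} x"
  have "x = E (- {- e..e}) x"
    by (simp add: E_compl x)
  also have "- {- e..e} = {e<..} \<union> {..<- e}"
    using \<open>e \<ge> 0\<close> by auto
  also have "E \<dots> x = p + m"
    using \<open>e \<ge> 0\<close> by (simp add: p_def m_def E_Un disjoint_iff)
  finally have x_eq: "x = p + m" .
  have disj: "{e<..} \<inter> {..<- e} = {}"
    using \<open>e \<ge> 0\<close> by auto
  have orth: "rinner (E {e<..} u) (E {..<- e} v) = 0" for u v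
    using E_disjoint[OF _ _ disj] by (simp add: E_sym rinner.zero_right)
  have "rinner p m = 0" "rinner (B p) m = 0" "rinner p (B m) = 0"
    unfolding p_def m_def by (simp_all add: E_commute orth)
  then have "rinner (B x) (p - m) = rinner (B p) p - rinner (B m) m"
    using B_sym[of m p] by (simp add: x_eq add rinner_simps rinner_commute)
  moreover have "e * (norm p)\<^sup>2 \<le> rinner (B p) p"
    unfolding p_def by (rule rinner_B_E_lower) auto
  moreover have "rinner (B m) m \<le> - e * (norm m)\<^sup>2"
    unfolding m_def by (rule rinner_B_E_upper) auto
  moreover have "(norm x)\<^sup>2 = (norm p)\<^sup>2 + (norm m)\<^sup>2"
    using \<open>rinner p m = 0\<close> by (simp add: x_eq norm_add_sq)
  ultimately have "e * (norm x)\<^sup>2 \<le> rinner (B x) (p - m)"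
    by (simp add: distrib_left)
  also have "\<dots> \<le> norm (B x) * norm (p - m)"
    using rinner_le_norm[of "B x" "p - m"] by simp
  also have "norm (p - m) = norm x"
  proof -
    have "(norm (p - m))\<^sup>2 = (norm x)\<^sup>2"
      using \<open>rinner p m = 0\<close> by (simp add: x_eq norm_add_sq norm_diff_sq)
    then show ?thesis
      by (simp add: power2_eq_iff_nonneg)
  qed
  finally have "(e * norm x) * norm x \<le> norm (B x) * norm x"
    by (simp add: power2_eq_square mult.assoc)
  then show ?thesis
    using False by simp
qed simp

lemma norm_complement_le:
  assumes "e > 0"
  shows "e * norm (x - E {- e..e} x) \<le> norm (B x)"
proof -
  have "e * norm (x - E {- e..e} x) \<le> norm (B (x - E {- e..e} x))"
    using assms by (intro norm_B_lower) (simp_all add: E_diff E_idem)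
  also have "\<dots> = norm (B x - E {- e..e} (B x))"
    by (simp add: diff E_commute)
  also have "\<dots> \<le> norm (B x)"
    using norm_projection_le[OF orthogonal_projection_compl[OF proj]] by simp
  finally show ?thesis .
qed

text \<open>Forwards, this is the upper bound for \<open>e = 0\<close>. Backwards, the lower bound
  makes \<open>x\<close> fixed by \<open>E {- e..e}\<close> for all \<open>e > 0\<close>, and the
  scalar measure is continuous from above along these intervals.\<close>

lemma E_zero_iff: "E {0} x = x \<longleftrightarrow> B x = 0"
proof
  assume "E {0} x = x"
  then show "B x = 0"
    using norm_B_upper[of 0 x] by simp
next
  assume "B x = 0"
  have fixed: "E {- e..e} x = x" if "e > 0" for e
  proof -
    have "e * norm (x - E {- e..e} x) \<le> 0"
      using norm_complement_le[OF that, of x] \<open>B x = 0\<close> by simp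
    then show ?thesis
      using that by (simp add: mult_le_0_iff)
  qed
  have "(\<lambda>n. measure (scalar_measure E x) {- (1 / Suc n)..1 / Suc n})
      \<longlonglongrightarrow> measure (scalar_measure E x) (\<Inter>n. {- (1 / Suc n)..1 / Suc n})"
  proof (rule finite_measure.finite_Lim_measure_decseq[OF finite_scalar])
    show "decseq (\<lambda>n. {- (1 / real (Suc n))..1 / Suc n})"
      by (rule decseq_SucI) (auto simp: field_simps)
  qed auto
  moreover have "(\<Inter>n. {- (1 / Suc n)..1 / Suc n}) = {0::real}"
  proof (intro set_eqI iffI)
    fix t :: real assume t: "t \<in> (\<Inter>n. {- (1 / Suc n)..1 / Suc n})"
    have "\<bar>t\<bar> \<le> 0"
    proof (rule LIMSEQ_le_const)
      show "(\<lambda>n. inverse (real (Suc n))) \<longlonglongrightarrow> 0"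
        by (rule LIMSEQ_inverse_real_of_nat)
      show "\<exists>N. \<forall>n\<ge>N. \<bar>t\<bar> \<le> inverse (real (Suc n))"
        using t by (auto simp: abs_le_iff inverse_eq_divide minus_le_iff)
    qed
    then show "t \<in> {0}"
      by simp
  qed auto
  ultimately have "(\<lambda>n. (norm x)\<^sup>2) \<longlonglongrightarrow> (norm (E {0} x))\<^sup>2"
    by (simp add: measure_scalar fixed)
  then have "(norm x)\<^sup>2 = (norm (E {0} x))\<^sup>2"
    by (simp add: LIMSEQ_const_iff)
  then show "E {0} x = x"
    using norm_projection_pythagoras[OF proj, of "{0}" x] by simp
qed

text \<open>\<open>B\<close> is bounded below on the kernel of \<open>E {- e..e}\<close>, so its
  image \<open>M\<close> is closed. The remainder \<open>w\<close> of \<open>x\<close> is orthogonal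
  to \<open>B (B w)\<close>, which lies in \<open>M\<close>, so \<open>B w = 0\<close> and
  \<open>w = 0\<close>. The norm bound keeps preimages of bounded sequences bounded.\<close>

lemma B_surj_on_complement:
  assumes "e > 0" and x: "E {- e..e} x = 0"
  obtains y where "E {- e..e} y = 0" and "B y = x" and "e * norm y \<le> norm x"
proof -
  let ?K = "E {- e..e}"
  interpret K: bounded_linear ?K
    by (rule E_linear) simp
  define M where "M = B ` {y. ?K y = 0}"
  have lower: "e * norm y \<le> norm (B y)" if "?K y = 0" for y
    using norm_B_lower[of e y] that \<open>e > 0\<close> by simp
  have "closed M"
    unfolding closed_sequential_limits
  proof (intro allI impI, elim conjE)
    fix s l assume "\<forall>n. s n \<in> M" and l: "s \<longlonglongrightarrow> l"
    then have "\<forall>n. \<exists>y. ?K y = 0 \<and> s n = B y"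
      by (auto simp: M_def)
    then obtain y where y: "\<And>n. ?K (y n) = 0" "\<And>n. s n = B (y n)"
      by metis
    have "Cauchy y"
    proof (rule Cauchy_if_dominated[OF \<open>e > 0\<close> _ LIMSEQ_imp_Cauchy[OF l]])
      show "e * norm (y m - y n) \<le> norm (s m - s n)" for m n
        using lower[of "y m - y n"] by (simp add: K.diff y diff)
    qed
    then obtain z where z: "y \<longlonglongrightarrow> z"
      using Cauchy_convergent convergent_def by blast
    have "?K z = 0"
      using K.tendsto[OF z] y(1) by (simp add: LIMSEQ_const_iff)
    moreover have "B z = l"
      using LIMSEQ_unique[OF tendsto[OF z] l[unfolded y(2)]] .
    ultimately show "l \<in> M"
      by (auto simp: M_def)
  qed
  moreover have "csubspace M"
    unfolding csubspace_def M_def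
  proof (safe, goal_cases)
    case 1
    show ?case
      by (rule image_eqI[of _ _ 0]) (simp_all add: zero K.zero)
  next
    case (2 _ y _ z)
    then show ?case
      by (intro image_eqI[of _ _ "y + z"]) (simp_all add: add K.add)
  next
    case (3 c _ y)
    then show ?case
      using bounded_selfadjointD(2)[OF orthogonal_projectionD(1)[OF proj], of "{- e..e}" c y]
      by (intro image_eqI[of _ _ "c *\<^sub>C y"])
        (simp_all add: bounded_selfadjointD(2)[OF selfadjoint] scaleC_zero_right)
  qed
  ultimately obtain u where "u \<in> M" and orth: "\<And>z. z \<in> M \<Longrightarrow> rinner (x - u) z = 0"
    using orthogonal_decomposition by blast
  then obtain y where y: "?K y = 0" "B y = u"
    by (auto simp: M_def)
  define w where "w = x - u"
  have KB: "?K (B z) = 0" if "?K z = 0" for z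
    using that by (simp add: zero flip: E_commute)
  have Kw: "?K w = 0"
    using KB[OF y(1)] y(2) by (simp add: w_def K.diff x)
  have "rinner w (B (B w)) = 0"
    using orth[of "B (B w)"] KB[OF Kw] by (auto simp: M_def w_def)
  then have "B w = 0"
    by (simp add: rinner_self flip: B_sym)
  then have "w = 0"
    using lower[OF Kw] \<open>e > 0\<close> by (simp add: mult_le_0_iff)
  then have "B y = x"
    using y by (simp add: w_def)
  with y lower[OF y(1)] that show thesis
    by blast
qed

end

section \<open>Sums of ranges\<close>

text \<open>Baire category: one of the closed sets \<open>F k\<close> covering the space contains a
  ball.\<close>

lemma uniform_boundedness_sequence:
  fixes z :: "nat \<Rightarrow> 'a::complex_hilbert"
  assumes bdd: "\<And>h. \<exists>C. \<forall>n. \<bar>rinner (z n) h\<bar> \<le> C"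
  shows "\<exists>K. \<forall>n. norm (z n) \<le> K"
proof -
  define F where "F k = {h. \<forall>n. \<bar>rinner (z n) h\<bar> \<le> real k}" for k
  have closed_F: "closed (F k)" for k
  proof -
    have "closed {h. \<bar>rinner (z n) h\<bar> \<le> real k}" for n
      by (intro closed_Collect_le continuous_intros linear_continuous_on[OF rinner.bounded_linear_right])
    then show ?thesis
      by (simp add: F_def Collect_all_eq closed_INT)
  qed
  have "(\<Union>k. F k) = UNIV"
  proof (intro set_eqI iffI UNIV_I)
    fix h
    obtain C where C: "\<And>n. \<bar>rinner (z n) h\<bar> \<le> C"
      using bdd by blast
    obtain k where "C \<le> real k"
      using real_arch_simple by blast
    with C show "h \<in> (\<Union>k. F k)"
      by (auto simp: F_def intro: order_trans)
  qed
  have "\<exists>k. interior (F k) \<noteq> {}"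
  proof (rule ccontr)
    assume "\<not> ?thesis"
    then have "Met_TC.mtopology interior_of \<Union>(range F) = {}"
      by (intro Met_TC.metric_Baire_category_alt) (auto simp: closed_F complete_UNIV)
    then show False
      using \<open>(\<Union>k. F k) = UNIV\<close> by simp
  qed
  then obtain k h where "h \<in> interior (F k)"
    by blast
  then obtain r where "r > 0" and r: "cball h r \<subseteq> F k"
    using mem_interior_cball by blast
  have "norm (z n) \<le> 2 * real k / r" for n
  proof (cases "z n = 0")
    case False
    \<comment> \<open>The vector of length \<open>r\<close> along \<open>z n\<close>: both the
      centre \<open>h\<close> and \<open>h + g\<close> lie in the ball, and their difference detects
      \<open>norm (z n)\<close>.\<close>
    define g where "g = (r / norm (z n)) *\<^sub>R z n"
    have "h \<in> F k" "h + g \<in> F k"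
      using r \<open>r > 0\<close> False by (auto simp: g_def dist_norm subset_iff)
    then have "\<bar>rinner (z n) (h + g)\<bar> \<le> k" "\<bar>rinner (z n) h\<bar> \<le> k"
      by (auto simp: F_def)
    then have "rinner (z n) g \<le> 2 * real k"
      by (simp add: rinner_add_right)
    moreover have "rinner (z n) g = r * norm (z n)"
      using False by (simp add: g_def rinner_scaleR_right rinner_self power2_eq_square)
    ultimately show ?thesis
      using \<open>r > 0\<close> by (simp add: field_simps)
  qed (use \<open>r > 0\<close> in simp)
  then show ?thesis
    by blast
qed

text \<open>The hypothesis covers every subsequence \<open>r\<close>, so the index set can be
  exhausted by repeated refinement.\<close>

lemma common_convergent_subsequence:
  fixes f :: "'i \<Rightarrow> nat \<Rightarrow> 'b::topological_space"
  assumes "finite I"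
    and sub: "\<And>i (r :: nat \<Rightarrow> nat). i \<in> I \<Longrightarrow> strict_mono r \<Longrightarrow>
      \<exists>s :: nat \<Rightarrow> nat. strict_mono s \<and> convergent (\<lambda>n. f i (r (s n)))"
  shows "\<exists>r :: nat \<Rightarrow> nat. strict_mono r \<and> (\<forall>i\<in>I. convergent (\<lambda>n. f i (r n)))"
  using assms
proof (induction I rule: finite_induct)
  case empty
  then show ?case
    by (auto intro: strict_mono_id[unfolded id_def])
next
  case (insert i I)
  then obtain r :: "nat \<Rightarrow> nat" where r: "strict_mono r" "\<And>j. j \<in> I \<Longrightarrow> convergent (\<lambda>n. f j (r n))"
    by (metis insertCI)
  obtain s :: "nat \<Rightarrow> nat" where s: "strict_mono s" "convergent (\<lambda>n. f i (r (s n)))"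
    using insert.prems[of i r] r(1) by blast
  have "convergent (\<lambda>n. f j (r (s n)))" if "j \<in> I" for j
    using convergent_subseq_convergent[OF r(2)[OF that] s(1)] by (simp add: o_def)
  with s r(1) show ?case
    by (intro exI[of _ "\<lambda>n. r (s n)"]) (auto simp: strict_mono_def)
qed

text \<open>The last assumption says that \<open>Q i \<circ> Q j\<close> is compact for \<open>i \<noteq> j\<close>. Hence the Gram operator
  \<open>(Q i \<circ> Q j)\<close> on the direct sum of the ranges is a compact perturbation of the identity.\<close>

locale almost_orthogonal_projections =
  fixes I :: "'i set" and Q :: "'i \<Rightarrow> 'a::complex_hilbert \<Rightarrow> 'a"
  assumes finite: "finite I" and proj: "\<And>i. i \<in> I \<Longrightarrow> orthogonal_projection (Q i)"
    and compact: "\<And>i j q. i \<in> I \<Longrightarrow> j \<in> I \<Longrightarrow> i \<noteq> j \<Longrightarrow> bounded (range q) \<Longrightarrow> (\<And>n. Q j (q n) = q n) \<Longrightarrow>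
      \<exists>s::nat \<Rightarrow> nat. strict_mono s \<and> convergent (\<lambda>n. Q i (q (s n)))"
begin

text \<open>The size is attached to a decomposition rather than to \<open>y\<close>, as the ranges
  may intersect and \<open>y\<close> may have several decompositions.\<close>

definition decomposes :: "('i \<Rightarrow> 'a) \<Rightarrow> 'a \<Rightarrow> bool" where
  "decomposes q y \<longleftrightarrow> (\<forall>i\<in>I. Q i (q i) = q i) \<and> (\<Sum>i\<in>I. q i) = y"

definition size_of :: "('i \<Rightarrow> 'a) \<Rightarrow> real" where
  "size_of q = (\<Sum>i\<in>I. norm (q i))"

lemma Q_linear: "i \<in> I \<Longrightarrow> bounded_linear (Q i)"
  using bounded_selfadjointD(1) orthogonal_projectionD(1) proj by blast

lemma size_of_nonneg: "0 \<le> size_of q"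
  by (simp add: size_of_def sum_nonneg)

lemma norm_le_size_of: "i \<in> I \<Longrightarrow> norm (q i) \<le> size_of q"
  unfolding size_of_def by (rule member_le_sum) (auto simp: finite)

lemma decomposes_scaleR: "decomposes q y \<Longrightarrow> decomposes (\<lambda>i. c *\<^sub>R q i) (c *\<^sub>R y)"
  using linear_scale[OF bounded_linear.linear[OF Q_linear]]
  by (auto simp: decomposes_def scaleR_sum_right)

lemma size_of_scaleR: "size_of (\<lambda>i. c *\<^sub>R q i) = \<bar>c\<bar> * size_of q"
  by (simp add: size_of_def sum_distrib_left)

lemma decomposes_diff: "decomposes q y \<Longrightarrow> decomposes p x \<Longrightarrow> decomposes (\<lambda>i. q i - p i) (y - x)"
  using linear_diff[OF bounded_linear.linear[OF Q_linear]]
  by (auto simp: decomposes_def sum_subtractf)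

lemma decomposition_subsequence:
  assumes q: "\<And>n. decomposes (q n) (y n)" and bdd: "\<And>n. size_of (q n) \<le> K" and y: "y \<longlonglongrightarrow> l"
  obtains r :: "nat \<Rightarrow> nat" and p where "strict_mono r"
    and "\<And>i. i \<in> I \<Longrightarrow> (\<lambda>n. q (r n) i) \<longlonglongrightarrow> p i" and "decomposes p l"
proof -
  have fixed: "Q i (q n i) = q n i" if "i \<in> I" for i n
    using q[of n] that by (simp add: decomposes_def)
  define J where "J = {(i, j). i \<in> I \<and> j \<in> I \<and> i \<noteq> j}"
  have "finite J"
    by (rule finite_subset[of _ "I \<times> I"]) (auto simp: J_def finite)
  have "\<exists>r::nat \<Rightarrow> nat. strict_mono r \<and> (\<forall>ij\<in>J. convergent (\<lambda>n. case ij of (i, j) \<Rightarrow> Q i (q (r n) j)))"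
  proof (rule common_convergent_subsequence[where f = "\<lambda>ij n. case ij of (i, j) \<Rightarrow> Q i (q n j)", OF \<open>finite J\<close>])
    fix ij and r :: "nat \<Rightarrow> nat" assume "ij \<in> J"
    then obtain i j where ij: "ij = (i, j)" "i \<in> I" "j \<in> I" "i \<noteq> j"
      by (auto simp: J_def)
    have "bounded (range (\<lambda>n. q (r n) j))"
      by (rule boundedI[where B = K]) (auto intro: order_trans[OF norm_le_size_of bdd] ij)
    then have "\<exists>s. strict_mono s \<and> convergent (\<lambda>n. Q i (q (r (s n)) j))"
      using compact[of i j "\<lambda>n. q (r n) j"] ij fixed by blast
    then show "\<exists>s. strict_mono s \<and> convergent (\<lambda>n. case ij of (i, j) \<Rightarrow> Q i (q (r (s n)) j))"
      by (simp add: ij)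
  qed
  then obtain r :: "nat \<Rightarrow> nat" where r: "strict_mono r"
    and conv: "\<And>i j. i \<in> I \<Longrightarrow> j \<in> I \<Longrightarrow> i \<noteq> j \<Longrightarrow> convergent (\<lambda>n. Q i (q (r n) j))"
    unfolding J_def by fastforce
  have yr: "(\<lambda>n. y (r n)) \<longlonglongrightarrow> l"
    using LIMSEQ_subseq_LIMSEQ[OF y r] by (simp add: o_def)
  have "convergent (\<lambda>n. q (r n) i)" if "i \<in> I" for i
  proof -
    interpret Qi: bounded_linear "Q i"
      by (rule Q_linear[OF that])
    \<comment> \<open>The compact perturbation at work: each component equals the convergent
      \<open>Q i (y (r n))\<close> minus cross terms, which converge along the chosen
      subsequence.\<close>
    have "q (r n) i = Q i (y (r n)) - (\<Sum>j\<in>I - {i}. Q i (q (r n) j))" for n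
    proof -
      have "y (r n) = q (r n) i + (\<Sum>j\<in>I - {i}. q (r n) j)"
        using q[of "r n"] that finite by (simp add: decomposes_def sum.remove)
      then show ?thesis
        by (simp add: Qi.add Qi.sum fixed[OF that])
    qed
    moreover have "convergent (\<lambda>n. Q i (y (r n)) - (\<Sum>j\<in>I - {i}. Q i (q (r n) j)))"
      using conv that Qi.tendsto[OF yr] by (intro convergent_diff convergent_sum) (auto simp: convergent_def)
    ultimately show ?thesis
      by simp
  qed
  then have "\<forall>i. \<exists>p. i \<in> I \<longrightarrow> (\<lambda>n. q (r n) i) \<longlonglongrightarrow> p"
    by (auto simp: convergent_def)
  then obtain p where p: "\<And>i. i \<in> I \<Longrightarrow> (\<lambda>n. q (r n) i) \<longlonglongrightarrow> p i"
    by metis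
  have "decomposes p l"
    unfolding decomposes_def
  proof
    show "\<forall>i\<in>I. Q i (p i) = p i"
    proof
      fix i assume i: "i \<in> I"
      have "(\<lambda>n. q (r n) i) \<longlonglongrightarrow> Q i (p i)"
        using bounded_linear.tendsto[OF Q_linear[OF i] p[OF i]] by (simp add: fixed[OF i])
      then show "Q i (p i) = p i"
        using LIMSEQ_unique p[OF i] by blast
    qed
    have "(\<lambda>n. y (r n)) \<longlonglongrightarrow> (\<Sum>i\<in>I. p i)"
      using q tendsto_sum[of I "\<lambda>i n. q (r n) i" p sequentially] p by (simp add: decomposes_def)
    then show "(\<Sum>i\<in>I. p i) = l"
      using LIMSEQ_unique yr by blast
  qed
  with r p that show thesis
    by blast
qed

text \<open>Otherwise there would be decomposable \<open>u n \<longlonglongrightarrow> 0\<close> whose decompositions all have size at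
  least 1 but can be chosen of size at most 2; a limit of the latter decomposes 0, and subtracting it
  gives arbitrarily small decompositions.\<close>

lemma bounded_decomposition:
  "\<exists>C. \<forall>y q. decomposes q y \<longrightarrow> (\<exists>q'. decomposes q' y \<and> size_of q' \<le> C * norm y)"
proof (rule ccontr)
  assume contra: "\<not> ?thesis"
  have "\<exists>u v. decomposes v u \<and> size_of v \<le> 2 \<and> norm u \<le> 1 / Suc n \<and> (\<forall>w. decomposes w u \<longrightarrow> 1 \<le> size_of w)" for n
  proof -
    obtain y q where q: "decomposes q y" and large: "\<And>q'. decomposes q' y \<Longrightarrow> real (Suc n) * norm y < size_of q'"
      using contra by (meson linorder_not_le)
    \<comment> \<open>A quotient norm of \<open>y\<close>, used to normalize. The infimum need not
      be attained, so a decomposition of size below \<open>2 * D\<close> is taken, whence the bound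
      2 for \<open>size_of v\<close>.\<close>
    define D where "D = Inf {size_of q' | q'. decomposes q' y}"
    have D_le: "D \<le> size_of q'" if "decomposes q' y" for q'
      unfolding D_def by (rule cInf_lower) (use that size_of_nonneg in \<open>auto intro!: bdd_belowI[of _ 0]\<close>)
    have "real (Suc n) * norm y \<le> D"
      unfolding D_def by (rule cInf_greatest) (use q large in \<open>auto intro: less_imp_le\<close>)
    moreover have "y \<noteq> 0"
    proof
      assume "y = 0"
      then have "decomposes (\<lambda>_. 0) y" "size_of (\<lambda>_. 0) = 0"
        using linear_0[OF bounded_linear.linear[OF Q_linear]] by (auto simp: decomposes_def size_of_def)
      then show False
        using large[of "\<lambda>_. 0"] \<open>y = 0\<close> by simp
    qed
    ultimately have "D > 0"
      by (smt (verit) mult_pos_pos of_nat_0_less_iff zero_less_Suc zero_less_norm_iff)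
    then have "\<exists>s \<in> {size_of q' | q'. decomposes q' y}. s < 2 * D"
      using q by (intro cInf_lessD) (auto simp: D_def)
    then obtain q' where q': "decomposes q' y" "size_of q' < 2 * D"
      by blast
    define u v where "u = (1 / D) *\<^sub>R y" and "v = (\<lambda>i. (1 / D) *\<^sub>R q' i)"
    have "decomposes v u"
      unfolding u_def v_def by (rule decomposes_scaleR[OF q'(1)])
    moreover have "size_of v \<le> 2"
      using q'(2) \<open>D > 0\<close> by (simp add: v_def size_of_scaleR field_simps)
    moreover have "norm u \<le> 1 / Suc n"
      using \<open>real (Suc n) * norm y \<le> D\<close> \<open>D > 0\<close> by (simp add: u_def field_simps)
    moreover have "1 \<le> size_of w" if "decomposes w u" for w
    proof -
      have "decomposes (\<lambda>i. D *\<^sub>R w i) y"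
        using decomposes_scaleR[OF that, of D] \<open>D > 0\<close> by (simp add: u_def)
      then show ?thesis
        using D_le[of "\<lambda>i. D *\<^sub>R w i"] \<open>D > 0\<close> by (simp add: size_of_scaleR)
    qed
    ultimately show ?thesis
      by blast
  qed
  then obtain u v where v: "\<And>n. decomposes (v n) (u n)" "\<And>n. size_of (v n) \<le> 2"
    and u: "\<And>n. norm (u n) \<le> 1 / Suc n" and ge: "\<And>n w. decomposes w (u n) \<Longrightarrow> 1 \<le> size_of w"
    by metis
  have "u \<longlonglongrightarrow> 0"
    by (rule Lim_null_comparison[OF _ LIMSEQ_inverse_real_of_nat])
      (simp add: u inverse_eq_divide del: of_nat_Suc)
  then obtain r :: "nat \<Rightarrow> nat" and p where p: "\<And>i. i \<in> I \<Longrightarrow> (\<lambda>n. v (r n) i) \<longlonglongrightarrow> p i" "decomposes p 0"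
    using decomposition_subsequence[where q = v and y = u, OF v] by metis
  have "(\<lambda>n. size_of (\<lambda>i. v (r n) i - p i)) \<longlonglongrightarrow> (\<Sum>i\<in>I. norm (p i - p i))"
    unfolding size_of_def by (intro tendsto_intros p)
  moreover have "1 \<le> size_of (\<lambda>i. v (r n) i - p i)" for n
    using decomposes_diff[OF v(1)[of "r n"] p(2)] ge[of _ "r n"] by simp
  ultimately have "1 \<le> (\<Sum>i\<in>I. norm (p i - p i))"
    using LIMSEQ_le_const by blast
  then show False
    by simp
qed

lemma mem_sum_ranges: "y \<in> {(\<Sum>i\<in>I. Q i (x i)) | x. True} \<longleftrightarrow> (\<exists>q. decomposes q y)"
proof
  assume "y \<in> {(\<Sum>i\<in>I. Q i (x i)) | x. True}"
  then obtain x where "y = (\<Sum>i\<in>I. Q i (x i))"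
    by blast
  then have "decomposes (\<lambda>i. Q i (x i)) y"
    by (simp add: decomposes_def orthogonal_projectionD(2)[OF proj])
  then show "\<exists>q. decomposes q y"
    by blast
next
  assume "\<exists>q. decomposes q y"
  then obtain q where "\<And>i. i \<in> I \<Longrightarrow> Q i (q i) = q i" "y = (\<Sum>i\<in>I. q i)"
    by (auto simp: decomposes_def)
  then have "y = (\<Sum>i\<in>I. Q i (q i))"
    by simp
  then show "y \<in> {(\<Sum>i\<in>I. Q i (x i)) | x. True}"
    by blast
qed

text \<open>A convergent sequence in the sum has decompositions of bounded size, and a limit of a
  subsequence of these decomposes the limit.\<close>

lemma closed_sum_ranges: "closed {(\<Sum>i\<in>I. Q i (x i)) | x. True}"
  unfolding closed_sequential_limits
proof (intro allI impI, elim conjE)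
  fix y l assume mem: "\<forall>n. y n \<in> {(\<Sum>i\<in>I. Q i (x i)) | x. True}" and y: "y \<longlonglongrightarrow> l"
  obtain C where C: "\<And>y q. decomposes q y \<Longrightarrow> \<exists>q'. decomposes q' y \<and> size_of q' \<le> C * norm y"
    using bounded_decomposition by blast
  obtain K where K: "\<And>n. norm (y n) \<le> K"
    using convergent_imp_Bseq[OF convergentI[OF y]] by (auto simp: Bseq_def)
  have "\<exists>q. decomposes q (y n) \<and> size_of q \<le> \<bar>C\<bar> * K" for n
  proof -
    obtain q where "decomposes q (y n)" "size_of q \<le> C * norm (y n)"
      using mem mem_sum_ranges C by blast
    moreover have "C * norm (y n) \<le> \<bar>C\<bar> * K"
      using K[of n] by (intro mult_mono) auto
    ultimately show ?thesis
      using order_trans by blast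
  qed
  then obtain q where "\<And>n. decomposes (q n) (y n)" "\<And>n. size_of (q n) \<le> \<bar>C\<bar> * K"
    by metis
  then obtain p where "decomposes p l"
    using decomposition_subsequence[where q = q and y = y, OF _ _ y] by metis
  then show "l \<in> {(\<Sum>i\<in>I. Q i (x i)) | x. True}"
    using mem_sum_ranges by blast
qed

end

lemma csubspace_sum_ranges:
  assumes A: "\<And>i. i \<in> I \<Longrightarrow> bounded_selfadjoint (A i)"
  shows "csubspace {(\<Sum>i\<in>I. A i (x i)) | x. True}"
  unfolding csubspace_def
proof (safe, goal_cases)
  case 1
  have "(\<Sum>i\<in>I. A i 0) = 0"
    using linear_0[OF bounded_linear.linear[OF bounded_selfadjointD(1)[OF A]]] by simp
  then show ?case
    by (intro exI[of _ "\<lambda>_. 0"]) simp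
next
  case (2 _ _ x y)
  have "(\<Sum>i\<in>I. A i (x i)) + (\<Sum>i\<in>I. A i (y i)) = (\<Sum>i\<in>I. A i (x i + y i))"
    using linear_add[OF bounded_linear.linear[OF bounded_selfadjointD(1)[OF A]]]
    by (simp add: sum.distrib)
  then show ?case
    by (intro exI[of _ "\<lambda>i. x i + y i"]) simp
next
  case (3 c _ x)
  have "c *\<^sub>C (\<Sum>i\<in>I. A i (x i)) = (\<Sum>i\<in>I. A i (c *\<^sub>C x i))"
    by (simp add: scaleC_sum_right bounded_selfadjointD(2)[OF A])
  then show ?case
    by (intro exI[of _ "\<lambda>i. c *\<^sub>C x i"]) simp
qed

lemma orthogonal_sum_ranges_iff:
  assumes "finite I" and A: "\<And>i. i \<in> I \<Longrightarrow> bounded_selfadjoint (A i)"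
  shows "(\<forall>z\<in>{(\<Sum>i\<in>I. A i (x i)) | x. True}. rinner w z = 0) \<longleftrightarrow> (\<forall>i\<in>I. A i w = 0)"
proof
  assume orth: "\<forall>z\<in>{(\<Sum>i\<in>I. A i (x i)) | x. True}. rinner w z = 0"
  show "\<forall>i\<in>I. A i w = 0"
  proof
    fix i assume i: "i \<in> I"
    \<comment> \<open>The element \<open>A i (A i w)\<close> of the sum is tested, because its inner
      product with \<open>w\<close> is \<open>(norm (A i w))\<^sup>2\<close>.\<close>
    have "(\<Sum>j\<in>I. A j (if j = i then A i w else 0)) = (\<Sum>j\<in>I. if j = i then A i (A i w) else 0)"
      using linear_0[OF bounded_linear.linear[OF bounded_selfadjointD(1)[OF A]]]
      by (intro sum.cong) auto
    also have "\<dots> = A i (A i w)"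
      using i \<open>finite I\<close> by simp
    finally have "A i (A i w) \<in> {(\<Sum>i\<in>I. A i (x i)) | x. True}"
      by (intro CollectI exI[of _ "\<lambda>j. if j = i then A i w else 0"]) simp
    then have "rinner w (A i (A i w)) = 0"
      by (rule orth[rule_format])
    then have "rinner (A i w) (A i w) = 0"
      by (simp add: bounded_selfadjointD(3)[OF A[OF i]])
    then show "A i w = 0"
      by (simp add: rinner_self)
  qed
next
  assume "\<forall>i\<in>I. A i w = 0"
  then have "rinner w (A i x) = 0" if "i \<in> I" for i x
    using bounded_selfadjointD(3)[OF A[OF that], of w x] that by (simp add: rinner.zero_left)
  then show "\<forall>z\<in>{(\<Sum>i\<in>I. A i (x i)) | x. True}. rinner w z = 0"
    by (auto simp: rinner.sum_right)
qed

section \<open>The two implications\<close>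

locale selfadjoint_family =
  fixes A :: "nat \<Rightarrow> 'a::complex_hilbert \<Rightarrow> 'a" and N :: nat
  assumes selfadjoint: "\<And>i. i \<in> {1..N} \<Longrightarrow> bounded_selfadjoint (A i)"
begin

abbreviation cut :: "real \<Rightarrow> nat \<Rightarrow> 'a \<Rightarrow> 'a" where
  "cut e i \<equiv> spectral_measure (A i) {- e..e}"

abbreviation sum_ranges :: "'a set" where
  "sum_ranges \<equiv> {(\<Sum>i=1..N. A i (x i)) | x. True}"

lemma operator: "i \<in> {1..N} \<Longrightarrow> operator_with_spectral_measure (A i) (spectral_measure (A i))"
  by (intro operator_with_spectral_measure.intro is_spectral_measure_spectral_measure selfadjoint)

lemma proj_cut: "i \<in> {1..N} \<Longrightarrow> orthogonal_projection (cut e i)"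
  by (rule operator_with_spectral_measure.proj[OF operator]) auto

lemma mem_joint_iff: "x \<in> joint_spectral_subspace N A e \<longleftrightarrow> (\<forall>i\<in>{1..N}. cut e i x = x)"
  using range_projection[OF proj_cut] by (auto simp: joint_spectral_subspace_def)

lemma joint_zero: "joint_spectral_subspace N A 0 = (\<Inter>i\<in>{1..N}. {x. A i x = 0})"
  using operator_with_spectral_measure.E_zero_iff[OF operator] by (auto simp: mem_joint_iff)

lemma closed_joint: "closed (joint_spectral_subspace N A e)"
  unfolding joint_spectral_subspace_def by (intro closed_INT ballI closed_range_projection proj_cut)

lemma csubspace_joint: "csubspace (joint_spectral_subspace N A e)"
  unfolding joint_spectral_subspace_def
  by (intro csubspace_INT csubspace_range_projection proj_cut)

lemma joint_mono:
  assumes "e \<ge> 0"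
  shows "joint_spectral_subspace N A 0 \<subseteq> joint_spectral_subspace N A e"
proof
  fix x assume "x \<in> joint_spectral_subspace N A 0"
  then have "spectral_measure (A i) {0} x = x" if "i \<in> {1..N}" for i
    using that by (simp add: mem_joint_iff)
  moreover have "{- e..e} \<inter> {0} = {0}"
    using assms by auto
  ultimately have "cut e i x = x" if "i \<in> {1..N}" for i
    using operator_with_spectral_measure.E_Int[OF operator[OF that], of "{- e..e}" "{0}" x] that by simp
  then show "x \<in> joint_spectral_subspace N A e"
    by (simp add: mem_joint_iff)
qed

lemma csubspace_sum: "csubspace sum_ranges"
  by (rule csubspace_sum_ranges) (rule selfadjoint)

lemma orthogonal_sum_iff: "(\<forall>z\<in>sum_ranges. rinner w z = 0) \<longleftrightarrow> w \<in> joint_spectral_subspace N A 0"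
  using orthogonal_sum_ranges_iff[of "{1..N}" A w] selfadjoint by (simp add: joint_zero)

lemma joint_stable_if_closed:
  assumes closed: "closed sum_ranges"
  shows "\<exists>e>0. joint_spectral_subspace N A e = joint_spectral_subspace N A 0"
proof (rule ccontr)
  assume contra: "\<not> ?thesis"
  let ?H = "joint_spectral_subspace N A"
  have "\<exists>z. z \<in> ?H (1 / Suc n) \<and> (\<forall>u\<in>?H 0. rinner z u = 0) \<and> norm z = Suc n" for n
  proof -
    have sub: "?H 0 \<subseteq> ?H (1 / Suc n)"
      by (rule joint_mono) simp
    moreover have "?H (1 / Suc n) \<noteq> ?H 0"
      using contra by (metis of_nat_0_less_iff zero_less_Suc zero_less_divide_1_iff)
    ultimately obtain x where x: "x \<in> ?H (1 / Suc n)" "x \<notin> ?H 0"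
      by blast
    obtain u where u: "u \<in> ?H 0" and orth: "\<And>v. v \<in> ?H 0 \<Longrightarrow> rinner (x - u) v = 0"
      using orthogonal_decomposition[OF closed_joint csubspace_joint] by blast
    \<comment> \<open>The length \<open>Suc n\<close> offsets exactly the bound
      \<open>1 / Suc n\<close> for \<open>A i\<close> on this subspace, giving
      \<open>norm (A i z) \<le> 1\<close>.\<close>
    define z where "z = (Suc n / norm (x - u)) *\<^sub>R (x - u)"
    have "x - u \<noteq> 0"
      using x u by auto
    then have "norm z = Suc n"
      by (simp add: z_def)
    moreover have "z \<in> ?H (1 / Suc n)"
      unfolding z_def using sub u x
      by (intro csubspace_scaleR[OF csubspace_joint] csubspace_diff[OF csubspace_joint]) auto
    moreover have "\<forall>v\<in>?H 0. rinner z v = 0"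
      by (simp add: z_def rinner_scaleR_left orth)
    ultimately show ?thesis
      by blast
  qed
  then obtain z where z: "\<And>n. z n \<in> ?H (1 / Suc n)" "\<And>n u. u \<in> ?H 0 \<Longrightarrow> rinner (z n) u = 0"
      "\<And>n. norm (z n) = Suc n"
    by metis
  have Az: "norm (A i (z n)) \<le> 1" if "i \<in> {1..N}" for i n
    using operator_with_spectral_measure.norm_B_upper[OF operator[OF that], of "1 / Suc n" "z n"]
      z(1)[of n] z(3)[of n] that unfolding mem_joint_iff by simp
  have "\<exists>C. \<forall>n. \<bar>rinner (z n) h\<bar> \<le> C" for h
  proof -
    \<comment> \<open>The part \<open>h - v\<close> lies in the common kernel, to which
      \<open>z n\<close> is orthogonal. In \<open>v\<close> each \<open>A i\<close> can be moved
      over to \<open>z n\<close>, so the norms of the \<open>y i\<close> bound the inner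
      product.\<close>
    obtain v where "v \<in> sum_ranges" and orth: "\<And>w. w \<in> sum_ranges \<Longrightarrow> rinner (h - v) w = 0"
      using orthogonal_decomposition[OF closed csubspace_sum] by blast
    then obtain y where v: "v = (\<Sum>i=1..N. A i (y i))"
      by blast
    have "h - v \<in> ?H 0"
      using orth orthogonal_sum_iff by blast
    have "\<bar>rinner (z n) h\<bar> \<le> (\<Sum>i=1..N. norm (y i))" for n
    proof -
      have "rinner (z n) h = rinner (z n) v"
        using z(2)[OF \<open>h - v \<in> ?H 0\<close>, of n] by (simp add: rinner.diff_right)
      also have "\<dots> = (\<Sum>i=1..N. rinner (A i (z n)) (y i))"
        by (simp add: v rinner.sum_right bounded_selfadjointD(3)[OF selfadjoint])
      also have "\<bar>\<dots>\<bar> \<le> (\<Sum>i=1..N. norm (y i))"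
      proof (rule order_trans[OF sum_abs sum_mono])
        fix i assume i: "i \<in> {1..N}"
        have "\<bar>rinner (A i (z n)) (y i)\<bar> \<le> norm (A i (z n)) * norm (y i)"
          by (rule rinner_le_norm)
        also have "\<dots> \<le> norm (y i)"
          using Az[OF i, of n] by (simp add: mult_left_le_one_le)
        finally show "\<bar>rinner (A i (z n)) (y i)\<bar> \<le> norm (y i)" .
      qed
      finally show ?thesis .
    qed
    then show ?thesis
      by blast
  qed
  then obtain K where K: "\<And>n. norm (z n) \<le> K"
    using uniform_boundedness_sequence[of z] by blast
  obtain n where "K < real n"
    using reals_Archimedean2 by blast
  then show False
    using K[of n] z(3)[of n] by simp
qed

text \<open>If \<open>Q i\<close> is the spectral projection of \<open>A i\<close> off \<open>[-e, e]\<close>, the range of \<open>Q i\<close> lies in that of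
  \<open>A i\<close>, and by assumption both sums of ranges have the same orthogonal complement.\<close>

lemma closed_if_joint_stable:
  assumes compact: "\<And>i j. i \<in> {1..N} \<Longrightarrow> j \<in> {1..N} \<Longrightarrow> i \<noteq> j \<Longrightarrow> compact_operator (A i \<circ> A j)"
    and "e > 0" and stable: "joint_spectral_subspace N A e = joint_spectral_subspace N A 0"
  shows "closed sum_ranges"
proof -
  define Q where "Q i x = x - cut e i x" for i x
  have Q: "orthogonal_projection (Q i)" if "i \<in> {1..N}" for i
    unfolding Q_def by (rule orthogonal_projection_compl[OF proj_cut[OF that]])
  have lift: "\<exists>y. A i y = x \<and> e * norm y \<le> norm x" if "i \<in> {1..N}" "Q i x = x" for i x
    using operator_with_spectral_measure.B_surj_on_complement[OF operator[OF that(1)] \<open>e > 0\<close>, of x] that(2)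
    by (metis Q_def diff_eq_eq add_cancel_right_right)
  have dominated: "e * norm (Q i x) \<le> norm (A i x)" if "i \<in> {1..N}" for i x
    unfolding Q_def
    by (rule operator_with_spectral_measure.norm_complement_le[OF operator[OF that] \<open>e > 0\<close>])
  interpret almost_orthogonal_projections "{1..N}" Q
  proof
    fix i j and q :: "nat \<Rightarrow> 'a"
    assume i: "i \<in> {1..N}" and j: "j \<in> {1..N}" and "i \<noteq> j" and bdd: "bounded (range q)"
      and q: "\<And>n. Q j (q n) = q n"
    \<comment> \<open>Compactness is given for \<open>A i \<circ> A j\<close>: bounded preimages
      \<open>y n\<close> under \<open>A j\<close> yield a convergent subsequence of
      \<open>A i (q n)\<close>, and the bound \<open>dominated\<close> carries it over to
      \<open>Q i\<close>.\<close>
    obtain y where y: "\<And>n. A j (y n) = q n" "\<And>n. e * norm (y n) \<le> norm (q n)"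
      using lift[OF j q] by metis
    obtain K where K: "\<And>n. norm (q n) \<le> K"
      using bdd by (auto simp: bounded_iff)
    have "norm (y n) \<le> K / e" for n
      using order_trans[OF y(2) K, of n] \<open>e > 0\<close> by (simp add: field_simps)
    then have "bounded (range y)"
      by (auto simp: bounded_iff)
    then have "compact (closure ((A i \<circ> A j) ` range y))"
      using compact[OF i j \<open>i \<noteq> j\<close>] by (simp add: compact_operator_def)
    moreover have "A i (q n) \<in> closure ((A i \<circ> A j) ` range y)" for n
      by (intro subsetD[OF closure_subset] image_eqI[of _ _ "y n"]) (simp_all add: y(1))
    ultimately have "\<exists>l\<in>closure ((A i \<circ> A j) ` range y). \<exists>s::nat \<Rightarrow> nat. strict_mono s \<and>
        ((\<lambda>n. A i (q n)) \<circ> s) \<longlonglongrightarrow> l"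
      unfolding compact_def by (elim allE[of _ "\<lambda>n. A i (q n)"] impE) auto
    then obtain l s where s: "strict_mono (s :: nat \<Rightarrow> nat)" "((\<lambda>n. A i (q n)) \<circ> s) \<longlonglongrightarrow> l"
      by blast
    have Cauchy: "Cauchy (\<lambda>n. A i (q (s n)))"
      using LIMSEQ_imp_Cauchy[OF s(2)] by (simp add: o_def)
    have "Cauchy (\<lambda>n. Q i (q (s n)))"
    proof (rule Cauchy_if_dominated[OF \<open>e > 0\<close> _ Cauchy])
      fix m n
      interpret Ai: bounded_linear "A i"
        using bounded_selfadjointD(1)[OF selfadjoint[OF i]] .
      interpret Qi: bounded_linear "Q i"
        using bounded_selfadjointD(1)[OF orthogonal_projectionD(1)[OF Q[OF i]]] .
      show "e * norm (Q i (q (s m)) - Q i (q (s n))) \<le> norm (A i (q (s m)) - A i (q (s n)))"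
        using dominated[OF i, of "q (s m) - q (s n)"] by (simp add: Ai.diff Qi.diff)
    qed
    then show "\<exists>s::nat \<Rightarrow> nat. strict_mono s \<and> convergent (\<lambda>n. Q i (q (s n)))"
      using s(1) Cauchy_convergent by blast
  qed (simp_all add: Q)
  let ?M = "{(\<Sum>i=1..N. Q i (x i)) | x. True}"
  have "?M \<subseteq> sum_ranges"
  proof
    fix v assume "v \<in> ?M"
    then obtain x where v: "v = (\<Sum>i=1..N. Q i (x i))"
      by blast
    have "\<forall>i. \<exists>y. i \<in> {1..N} \<longrightarrow> A i y = Q i (x i)"
      using lift orthogonal_projectionD(2)[OF Q] by metis
    then obtain y where "\<And>i. i \<in> {1..N} \<Longrightarrow> A i (y i) = Q i (x i)"
      by metis
    then have "v = (\<Sum>i=1..N. A i (y i))"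
      by (simp add: v)
    then show "v \<in> sum_ranges"
      by blast
  qed
  moreover have "sum_ranges \<subseteq> ?M"
  proof
    fix v assume v: "v \<in> sum_ranges"
    have "csubspace ?M"
      by (rule csubspace_sum_ranges) (rule orthogonal_projectionD(1)[OF Q])
    then obtain u where u: "u \<in> ?M" and orth: "\<And>w. w \<in> ?M \<Longrightarrow> rinner (v - u) w = 0"
      using orthogonal_decomposition[OF closed_sum_ranges] by blast
    \<comment> \<open>The remainder \<open>v - u\<close> is fixed by all cut-offs, so by stability
      it lies in the common kernel and is orthogonal to \<open>sum_ranges\<close>. It also belongs
      to \<open>sum_ranges\<close>, hence is 0.\<close>
    have "\<forall>i\<in>{1..N}. Q i (v - u) = 0"
      using orthogonal_sum_ranges_iff[of "{1..N}" Q "v - u"] orth orthogonal_projectionD(1)[OF Q] by blast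
    then have "v - u \<in> joint_spectral_subspace N A e"
      by (simp add: mem_joint_iff Q_def)
    then have "v - u \<in> joint_spectral_subspace N A 0"
      by (simp add: stable)
    moreover have "v - u \<in> sum_ranges"
      using u v \<open>?M \<subseteq> sum_ranges\<close> by (intro csubspace_diff[OF csubspace_sum]) blast+
    ultimately have "rinner (v - u) (v - u) = 0"
      using orthogonal_sum_iff by blast
    then show "v \<in> ?M"
      using u by (simp add: rinner_self)
  qed
  ultimately have "?M = sum_ranges"
    by (rule subset_antisym)
  with closed_sum_ranges show ?thesis
    by argo
qed

end

theorem theorem1:
  fixes A :: "nat \<Rightarrow> 'a::complex_hilbert \<Rightarrow> 'a" and N :: nat
  assumes "N \<ge> 2"
    and "\<And>i. i \<in> {1..N} \<Longrightarrow> bounded_selfadjoint (A i)"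
    and "\<And>i j. i \<in> {1..N} \<Longrightarrow> j \<in> {1..N} \<Longrightarrow> i \<noteq> j \<Longrightarrow> compact_operator (A i \<circ> A j)"
  shows "joint_spectral_subspace N A 0 = (\<Inter>i\<in>{1..N}. {x. A i x = 0}) \<and>
    (closed {(\<Sum>i=1..N. A i (x i)) | x. True} \<longleftrightarrow>
      (\<exists>\<epsilon>>0. joint_spectral_subspace N A \<epsilon> = joint_spectral_subspace N A 0))"
proof -
  interpret selfadjoint_family A N
    by unfold_locales (rule assms(2))
  show ?thesis
  proof (intro conjI iffI)
    show "closed {(\<Sum>i=1..N. A i (x i)) | x. True}"
      if "\<exists>\<epsilon>>0. joint_spectral_subspace N A \<epsilon> = joint_spectral_subspace N A 0"
      using that by (elim exE conjE) (rule closed_if_joint_stable[OF assms(3)])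
  qed (fact joint_zero, rule joint_stable_if_closed)
qed

end
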